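(* Let $\alpha \in (\tfrac{3}{2}, 2]$ and let $X^1, X^2$ be independent real-valued symmetric $\alpha$-stable processes with the same index of stability $\alpha$. Let $\theta$ be the derivative of the intersection local time of $X^1$ and $X^2$ on $[0,1]$, formally $$\theta = \frac{i}{2\pi}\int_0^1\int_0^1\int_{\mathbb{R}} p\, e^{ip(X^1_t - X^2_s)}\,dp\,ds\,dt .$$ Let $\beta \in [0, \tfrac{\alpha}{3})$. Then there exists a constant $M > 0$ such that $\mathbb{E}[\exp\{M|\theta|^{\beta}\}] < \infty$.
   Context: A symmetric $\alpha$-stable process ($\alpha\in(0,2]$) is a real-valued Lévy process $X$ with $X_0=0$ whose characteristic function is $\mathbb{E}[e^{iuX_t}] = e^{-t\sigma^\alpha |u|^\alpha}$ for some $\sigma>0$; the case $\alpha=2$ is (a constant multiple of) Brownian motion. The formal expression for $\theta$ is made rigorous as the limit, as $\epsilon\downarrow 0$, of the regularized quantities $\frac{i}{2\pi}\int_0^1\int_0^1\int_{\mathbb{R}} p\, e^{ip(X^1_t - X^2_s)} e^{-\epsilon p^2/2}\,dp\,ds\,dt$ (existence of this limit, i.e. of the derivative of intersection local time, is known from Rosen's work). A random variable $Y$ is exponentially integrable of order $\beta$ if $\mathbb{E}[\exp\{M|Y|^\beta\}]<\infty$ for some $M>0$. *)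

theory Defs
  imports "HOL-Probability.Probability"
begin

definition cadlag_path :: "(real \<Rightarrow> real) \<Rightarrow> bool" where
  "cadlag_path f \<longleftrightarrow>
     (\<forall>t\<ge>0. (f \<longlongrightarrow> f t) (at_right t)) \<and>
     (\<forall>t>0. \<exists>l. (f \<longlongrightarrow> l) (at_left t))"

definition sym_stable_process ::
  "'a measure \<Rightarrow> real \<Rightarrow> real \<Rightarrow> (real \<Rightarrow> 'a \<Rightarrow> real) \<Rightarrow> bool" where
  "sym_stable_process M \<alpha> \<sigma> X \<longleftrightarrow>
     prob_space M \<and> 0 < \<alpha> \<and> \<alpha> \<le> 2 \<and> 0 < \<sigma> \<and>
     (\<forall>t. X t \<in> borel_measurable M) \<and>
     (AE \<omega> in M. X 0 \<omega> = 0) \<and>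
     (\<forall>\<omega>\<in>space M. cadlag_path (\<lambda>t. X t \<omega>)) \<and>
     (\<forall>t::nat \<Rightarrow> real. incseq t \<and> 0 \<le> t 0 \<longrightarrow>
        prob_space.indep_vars M (\<lambda>_. borel) (\<lambda>i \<omega>. X (t (Suc i)) \<omega> - X (t i) \<omega>) UNIV) \<and>
     (\<forall>s t. 0 \<le> s \<and> s \<le> t \<longrightarrow>
        distr M borel (\<lambda>\<omega>. X t \<omega> - X s \<omega>) = distr M borel (X (t - s))) \<and>
     (\<forall>t\<ge>0. \<forall>u. char (distr M borel (X t)) u
                 = complex_of_real (exp (- (t * \<sigma> powr \<alpha> * \<bar>u\<bar> powr \<alpha>))))"

definition indep_processes ::
  "'a measure \<Rightarrow> (real \<Rightarrow> 'a \<Rightarrow> real) \<Rightarrow> (real \<Rightarrow> 'a \<Rightarrow> real) \<Rightarrow> bool" where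
  "indep_processes M X Y \<longleftrightarrow>
     prob_space.indep_var M
       (Pi\<^sub>M {0..} (\<lambda>_. borel)) (\<lambda>\<omega>. \<lambda>t\<in>{0..}. X t \<omega>)
       (Pi\<^sub>M {0..} (\<lambda>_. borel)) (\<lambda>\<omega>. \<lambda>t\<in>{0..}. Y t \<omega>)"

definition theta_eps ::
  "(real \<Rightarrow> 'a \<Rightarrow> real) \<Rightarrow> (real \<Rightarrow> 'a \<Rightarrow> real) \<Rightarrow> real \<Rightarrow> 'a \<Rightarrow> complex" where
  "theta_eps X1 X2 \<epsilon> \<omega> =
     (\<i> / (2 * complex_of_real pi)) *
     (CLBINT t=0..1. (CLBINT s=0..1. (CLBINT p.
        complex_of_real p * iexp (p * (X1 t \<omega> - X2 s \<omega>)) * complex_of_real (exp (- \<epsilon> * p\<^sup>2 / 2)))))"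

definition conv_in_prob_at0 ::
  "'a measure \<Rightarrow> (real \<Rightarrow> 'a \<Rightarrow> complex) \<Rightarrow> ('a \<Rightarrow> complex) \<Rightarrow> bool" where
  "conv_in_prob_at0 M Z Y \<longleftrightarrow>
     (\<forall>e>0. ((\<lambda>\<epsilon>. measure M {\<omega>\<in>space M. e < cmod (Z \<epsilon> \<omega> - Y \<omega>)}) \<longlongrightarrow> 0) (at_right 0))"

end

theory Submission
  imports Defs "HOL-Real_Asymp.Real_Asymp"
begin

text \<open>
  The moments \<open>E |\<theta>\<^sub>\<epsilon>|\<^sup>n\<close> for even \<open>n\<close> are bounded by \<open>(C n powr (2 / \<alpha>))\<^sup>n\<close>, uniformly in
  \<open>\<epsilon>\<close>; this even gives exponential integrability of every order \<open>\<beta> \<le> \<alpha> / 2\<close>.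
  By independence the \<open>n\<close>-th moment is at most the integral over \<open>p\<close> of
  \<open>\<Prod>\<bar>p\<^sub>k\<bar> G\<^sub>1(p) G\<^sub>2(p) \<le> \<Prod>\<bar>p\<^sub>k\<bar> (G\<^sub>1(p)\<^sup>2 + G\<^sub>2(p)\<^sup>2)\<close>, where \<open>G\<^sub>j(p)\<close> is the integral
  over the unit cube of the characteristic function of \<open>(X\<^sub>j(t\<^sub>1), \<dots>, X\<^sub>j(t\<^sub>n))\<close> at \<open>p\<close>.
  Splitting the cube into simplices and bounding the indicator of \<open>max t \<le> 1\<close> by
  \<open>exp (\<kappa> (1 - max t))\<close> makes the time integrals factorise, so that \<open>G\<^sub>j\<close> is at most a sum over
  the permutations of \<open>e\<^sup>\<kappa> \<Prod> 1 / (\<kappa> + c \<bar>v\<^sub>k\<bar> powr \<alpha>)\<close> with \<open>v\<^sub>k = \<Sum>\<^sub>j\<^sub>\<ge>\<^sub>k p\<^sub>j\<close>.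
  With \<open>\<rho> = \<kappa> powr (1 / \<alpha>)\<close> one has \<open>\<rho> \<bar>p\<^sub>k\<bar> \<le> (\<rho> + \<bar>v\<^sub>k\<bar>) (\<rho> + \<bar>v\<^sub>k\<^sub>+\<^sub>1\<bar>)\<close>, so the
  \<open>p\<close>-integral factorises as well; its factors are finite precisely because \<open>\<alpha> > 3/2\<close>. The choice
  \<open>\<kappa> = n\<close> gives the stated growth.
\<close>

section \<open>Lebesgue measure on finite powers of the line\<close>

abbreviation lborel_pow :: "nat \<Rightarrow> (nat \<Rightarrow> real) measure" where
  "lborel_pow n \<equiv> Pi\<^sub>M {..<n} (\<lambda>_. lborel)"

interpretation lborel_pow: product_sigma_finite "\<lambda>_::nat. lborel::real measure"
  by standard

lemma sigma_finite_lborel_pow: "sigma_finite_measure (lborel_pow n)"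
proof -
  interpret finite_product_sigma_finite "\<lambda>_::nat. lborel::real measure" "{..<n}"
    by standard simp
  show ?thesis by (rule sigma_finite_measure_axioms)
qed

lemma measurable_permute_coords:
  assumes "\<pi> permutes {..<n}"
  shows "(\<lambda>x. \<lambda>i\<in>{..<n}. x (\<pi> i)) \<in> lborel_pow n \<rightarrow>\<^sub>M lborel_pow n"
proof (rule measurable_restrict)
  fix i assume "i \<in> {..<n}"
  then have "\<pi> i \<in> {..<n}" using permutes_in_image[OF assms] by blast
  then show "(\<lambda>x. x (\<pi> i)) \<in> measurable (lborel_pow n) lborel" by simp
qed

text \<open>A product measure is determined by its values on boxes. The preimage of the box with
  sides \<open>A i\<close> is the box with sides \<open>A (inv \<pi> i)\<close>, and a product of
  side lengths does not depend on their order.\<close>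

lemma distr_permute_coords:
  assumes "\<pi> permutes {..<n}"
  shows "distr (lborel_pow n) (lborel_pow n) (\<lambda>x. \<lambda>i\<in>{..<n}. x (\<pi> i)) = lborel_pow n"
proof (rule lborel_pow.PiM_eqI)
  fix A :: "nat \<Rightarrow> real set" assume A: "\<And>i. i \<in> {..<n} \<Longrightarrow> A i \<in> sets lborel"
  note inv = permutes_inv[OF assms] and mem = permutes_in_image[OF assms]
  have mem': "inv \<pi> i < n \<longleftrightarrow> i < n" for i using permutes_in_image[OF inv, of i] by simp
  have 1: "(\<lambda>x. \<lambda>i\<in>{..<n}. x (\<pi> i)) -` (Pi\<^sub>E {..<n} A) \<inter> space (lborel_pow n)
    = Pi\<^sub>E {..<n} (\<lambda>i. A (inv \<pi> i))" (is "?L = _")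
  proof -
    have "(\<forall>i<n. x (\<pi> i) \<in> A i) \<longleftrightarrow> (\<forall>i<n. x i \<in> A (inv \<pi> i))" for x :: "nat \<Rightarrow> real"
    proof safe
      fix i assume "\<forall>i<n. x (\<pi> i) \<in> A i" "i < n"
      then show "x i \<in> A (inv \<pi> i)"
        using mem'[of i] permutes_inverses(1)[OF assms, of i] by metis
    next
      fix i assume "\<forall>i<n. x i \<in> A (inv \<pi> i)" "i < n"
      then show "x (\<pi> i) \<in> A i"
        using mem[of i] permutes_inverses(2)[OF assms, of i] by (metis lessThan_iff)
    qed
    note eq = this
    have "x \<in> ?L \<longleftrightarrow> x \<in> Pi\<^sub>E {..<n} (\<lambda>i. A (inv \<pi> i))" for x
      using eq[of x] by (simp add: space_PiM PiE_iff Ball_def)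
    then show ?thesis by (rule set_eqI)
  qed
  have "emeasure (distr (lborel_pow n) (lborel_pow n) (\<lambda>x. \<lambda>i\<in>{..<n}. x (\<pi> i))) (Pi\<^sub>E {..<n} A)
      = emeasure (lborel_pow n) (Pi\<^sub>E {..<n} (\<lambda>i. A (inv \<pi> i)))"
    by (subst emeasure_distr[OF measurable_permute_coords[OF assms]])
       (use A 1 in \<open>auto intro!: sets_PiM_I_finite\<close>)
  also have "\<dots> = (\<Prod>i<n. emeasure lborel (A (inv \<pi> i)))"
    by (rule lborel_pow.emeasure_PiM) (use A mem' in auto)
  also have "\<dots> = (\<Prod>i<n. emeasure lborel (A i))"
    by (rule prod.permute[OF inv, symmetric, unfolded o_def])
  finally show "emeasure (distr (lborel_pow n) (lborel_pow n) (\<lambda>x. \<lambda>i\<in>{..<n}. x (\<pi> i))) (Pi\<^sub>E {..<n} A)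
      = (\<Prod>i\<in>{..<n}. emeasure lborel (A i))" .
qed simp_all

lemma nn_integral_permute_coords:
  assumes "\<pi> permutes {..<n}" and f: "f \<in> borel_measurable (lborel_pow n)"
    and cong: "\<And>x y. (\<And>i. i < n \<Longrightarrow> x i = y i) \<Longrightarrow> f x = f y"
  shows "(\<integral>\<^sup>+ x. f (\<lambda>i. x (\<pi> i)) \<partial>lborel_pow n) = (\<integral>\<^sup>+ x. f x \<partial>lborel_pow n)"
proof -
  have "(\<integral>\<^sup>+ x. f x \<partial>lborel_pow n) =
    (\<integral>\<^sup>+ x. f x \<partial>distr (lborel_pow n) (lborel_pow n) (\<lambda>x. \<lambda>i\<in>{..<n}. x (\<pi> i)))"
    using distr_permute_coords[OF assms(1)] by simp
  also have "\<dots> = (\<integral>\<^sup>+ x. f (\<lambda>i\<in>{..<n}. x (\<pi> i)) \<partial>lborel_pow n)"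
    by (subst nn_integral_distr[OF measurable_permute_coords[OF assms(1)]]) (use f in simp_all)
  also have "\<dots> = (\<integral>\<^sup>+ x. f (\<lambda>i. x (\<pi> i)) \<partial>lborel_pow n)"
    by (intro nn_integral_cong cong) simp
  finally show ?thesis by simp
qed

lemma borel_measurable_permute_coords:
  assumes "\<pi> permutes {..<n}" and f: "f \<in> borel_measurable (lborel_pow n)"
    and cong: "\<And>x y. (\<And>i. i < n \<Longrightarrow> x i = y i) \<Longrightarrow> f x = f y"
  shows "(\<lambda>x. f (\<lambda>i. x (\<pi> i))) \<in> borel_measurable (lborel_pow n)"
proof -
  have "(\<lambda>x. f (\<lambda>i. x (\<pi> i))) = (\<lambda>x. f (\<lambda>i\<in>{..<n}. x (\<pi> i)))"
    by (intro ext cong) simp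
  then show ?thesis
    using measurable_compose[OF measurable_permute_coords[OF assms(1)] f] by simp
qed

text \<open>The substitution is lower triangular with unit diagonal. When the last coordinate is
  integrated first, translation invariance of \<open>lborel\<close> removes the shift by the earlier
  ones. It serves twice: for the gaps between times and for the partial sums of momenta.\<close>

lemma nn_integral_triangular:
  fixes h :: "nat \<Rightarrow> real \<Rightarrow> ennreal" and a :: "nat \<Rightarrow> nat \<Rightarrow> real"
  assumes h[measurable]: "\<And>k. h k \<in> borel_measurable borel"
  shows "(\<integral>\<^sup>+ x. (\<Prod>k<n. h k (x k + (\<Sum>j<k. a k j * x j))) \<partial>lborel_pow n)
      = (\<Prod>k<n. \<integral>\<^sup>+ y. h k y \<partial>lborel)"
proof (induction n)
  case 0
  show ?case by (simp add: PiM_empty nn_integral_count_space_finite)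
next
  case (Suc n)
  have ins: "{..<Suc n} = insert n {..<n}" by auto
  let ?f = "\<lambda>m x. \<Prod>k<m. h k (x k + (\<Sum>j<k. a k j * x j))"
  have meas: "?f m \<in> borel_measurable (lborel_pow m)" for m
    by measurable
  \<comment> \<open>The factors below \<open>n\<close> involve earlier coordinates only, so updating
    coordinate \<open>n\<close> affects the last factor alone.\<close>
  have upd: "?f (Suc n) (x(n := y)) = ?f n x * h n (y + (\<Sum>j<n. a n j * x j))" for x y
    by (auto intro!: arg_cong2[where f="(*)"] prod.cong arg_cong[where f="h _"] sum.cong)
  have "(\<integral>\<^sup>+ x. ?f (Suc n) x \<partial>lborel_pow (Suc n))
      = (\<integral>\<^sup>+ x. (\<integral>\<^sup>+ y. ?f (Suc n) (x(n := y)) \<partial>lborel) \<partial>lborel_pow n)"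
    unfolding ins
    by (rule lborel_pow.product_nn_integral_insert) (use meas[of "Suc n"] in \<open>simp_all add: ins\<close>)
  also have "\<dots> = (\<integral>\<^sup>+ x. ?f n x * (\<integral>\<^sup>+ y. h n y \<partial>lborel) \<partial>lborel_pow n)"
  proof (rule nn_integral_cong)
    fix x
    have "(\<integral>\<^sup>+ y. ?f (Suc n) (x(n := y)) \<partial>lborel)
        = ?f n x * (\<integral>\<^sup>+ y. h n (y + (\<Sum>j<n. a n j * x j)) \<partial>lborel)"
      unfolding upd by (rule nn_integral_cmult) measurable
    also have "(\<integral>\<^sup>+ y. h n (y + (\<Sum>j<n. a n j * x j)) \<partial>lborel) = (\<integral>\<^sup>+ y. h n y \<partial>lborel)"
      using nn_integral_real_affine[of "h n" 1 "\<Sum>j<n. a n j * x j"] by (simp add: add.commute)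
    finally show "(\<integral>\<^sup>+ y. ?f (Suc n) (x(n := y)) \<partial>lborel) = ?f n x * (\<integral>\<^sup>+ y. h n y \<partial>lborel)" .
  qed
  also have "\<dots> = (\<integral>\<^sup>+ x. ?f n x \<partial>lborel_pow n) * (\<integral>\<^sup>+ y. h n y \<partial>lborel)"
    by (rule nn_integral_multc) (rule meas)
  finally show ?case using Suc.IH by simp
qed

section \<open>Sorting of times and products of momenta\<close>

lemma ex_sorting_permutation:
  fixes t :: "nat \<Rightarrow> 'b::linorder"
  shows "\<exists>\<pi>. \<pi> permutes {..<n} \<and> (\<forall>i j. i \<le> j \<longrightarrow> j < n \<longrightarrow> t (\<pi> i) \<le> t (\<pi> j))"
proof -
  let ?xs = "map t [0..<n]"
  obtain \<pi> where \<pi>: "\<pi> permutes {..<length ?xs}" "permute_list \<pi> ?xs = sort ?xs"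
    using mset_eq_permutation[of "sort ?xs" ?xs] by (metis mset_sort)
  have mem: "\<pi> i < n" if "i < n" for i
    using permutes_in_image[OF \<pi>(1), of i] that by simp
  have nth: "sort ?xs ! i = t (\<pi> i)" if "i < n" for i
    using permute_list_nth[OF \<pi>(1), of i] \<pi>(2) that mem[OF that] by simp
  have "t (\<pi> i) \<le> t (\<pi> j)" if "i \<le> j" "j < n" for i j
    using sorted_nth_mono[OF sorted_sort, of i j ?xs] nth that by simp
  then show ?thesis using \<pi>(1) by auto
qed

text \<open>Each \<open>p k\<close> is the difference of two neighbouring partial sums, hence is
  controlled by the product of \<open>\<rho> + \<bar>W k\<bar>\<close> and
  \<open>\<rho> + \<bar>W (Suc k)\<bar>\<close>. Over all \<open>k\<close> a partial sum occurs once
  as a left and once as a right neighbour, whence the square.\<close>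

lemma prod_abs_le_prod_partial_sums:
  fixes p :: "nat \<Rightarrow> real"
  assumes "0 < \<rho>"
  shows "(\<Prod>k<n. \<bar>p k\<bar>) \<le> (\<Prod>k<n. (\<rho> + \<bar>\<Sum>j\<le>k. p j\<bar>)\<^sup>2 / \<rho>)"
proof -
  define W where "W k = (\<Sum>j<k. p j)" for k
  have ineq: "\<bar>p k\<bar> \<le> (\<rho> + \<bar>W k\<bar>) * (\<rho> + \<bar>W (Suc k)\<bar>) / \<rho>" for k
  proof -
    have "\<rho> * \<bar>p k\<bar> \<le> \<rho> * (\<bar>W k\<bar> + \<bar>W (Suc k)\<bar>)"
      using assms by (intro mult_left_mono) (auto simp: W_def)
    also have "\<dots> \<le> (\<rho> + \<bar>W k\<bar>) * (\<rho> + \<bar>W (Suc k)\<bar>)"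
      using assms by (simp add: algebra_simps)
    finally show ?thesis using assms by (simp add: field_simps)
  qed
  \<comment> \<open>The two products differ by an index shift, hence only in their end factors:
    \<open>\<rho> + \<bar>W 0\<bar> = \<rho>\<close> against
    \<open>\<rho> + \<bar>W n\<bar>\<close>.\<close>
  have tel: "(\<Prod>k<n. \<rho> + \<bar>W k\<bar>) * (\<rho> + \<bar>W n\<bar>) = \<rho> * (\<Prod>k<n. \<rho> + \<bar>W (Suc k)\<bar>)"
    by (induction n) (simp_all add: W_def algebra_simps)
  have le: "(\<Prod>k<n. \<rho> + \<bar>W k\<bar>) \<le> (\<Prod>k<n. \<rho> + \<bar>W (Suc k)\<bar>)"
  proof -
    have "(\<Prod>k<n. \<rho> + \<bar>W k\<bar>) * \<rho> \<le> (\<Prod>k<n. \<rho> + \<bar>W k\<bar>) * (\<rho> + \<bar>W n\<bar>)"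
      using assms by (intro mult_left_mono prod_nonneg) auto
    then show ?thesis unfolding tel using assms by simp
  qed
  have "(\<Prod>k<n. \<bar>p k\<bar>) \<le> (\<Prod>k<n. (\<rho> + \<bar>W k\<bar>) * (\<rho> + \<bar>W (Suc k)\<bar>) / \<rho>)"
    using ineq by (intro prod_mono) auto
  also have "\<dots> = (\<Prod>k<n. \<rho> + \<bar>W k\<bar>) * (\<Prod>k<n. (\<rho> + \<bar>W (Suc k)\<bar>) / \<rho>)"
    by (simp add: prod.distrib[symmetric])
  also have "\<dots> \<le> (\<Prod>k<n. \<rho> + \<bar>W (Suc k)\<bar>) * (\<Prod>k<n. (\<rho> + \<bar>W (Suc k)\<bar>) / \<rho>)"
    using assms by (intro mult_right_mono le prod_nonneg) auto
  also have "\<dots> = (\<Prod>k<n. (\<rho> + \<bar>\<Sum>j\<le>k. p j\<bar>)\<^sup>2 / \<rho>)"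
    by (simp add: prod.distrib[symmetric] power2_eq_square W_def lessThan_Suc_atMost)
  finally show ?thesis .
qed

text \<open>Reversing the order of the momenta turns tail sums into partial sums. The bound on the
  product of the \<open>\<bar>p k\<bar>\<close> then makes the integrand a product of functions of
  one partial sum each, and the triangular substitution splits the integral.\<close>

lemma nn_integral_prod_abs_tail_sums_le:
  fixes h :: "real \<Rightarrow> ennreal"
  assumes h[measurable]: "h \<in> borel_measurable borel" and \<rho>: "0 < \<rho>"
  shows "(\<integral>\<^sup>+ p. ennreal (\<Prod>k<n. \<bar>p k\<bar>) * (\<Prod>k<n. h (\<Sum>j\<in>{k..<n}. p j)) \<partial>lborel_pow n)
      \<le> (\<integral>\<^sup>+ w. ennreal ((\<rho> + \<bar>w\<bar>)\<^sup>2 / \<rho>) * h w \<partial>lborel) ^ n"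
proof -
  \<comment> \<open>The reversal of \<open>{..<n}\<close>, continued by the identity so that it is a
    permutation and its own inverse.\<close>
  define r where "r i = (if i < n then n - Suc i else i)" for i
  have r: "r permutes {..<n}"
    by (rule bij_imp_permutes) (auto intro!: bij_betwI[where g=r] simp: r_def)
  let ?f = "\<lambda>p. ennreal (\<Prod>k<n. \<bar>p k\<bar>) * (\<Prod>k<n. h (\<Sum>j\<le>k. p j))"
  let ?g = "\<lambda>w. ennreal ((\<rho> + \<bar>w\<bar>)\<^sup>2 / \<rho>) * h w"
  have f: "?f \<in> borel_measurable (lborel_pow n)"
    by (intro borel_measurable_times_ennreal measurable_compose[OF _ measurable_ennreal]
       borel_measurable_prod measurable_compose[OF _ h] borel_measurable_sum borel_measurable_abs) auto
  have "ennreal (\<Prod>k<n. \<bar>p k\<bar>) * (\<Prod>k<n. h (\<Sum>j\<in>{k..<n}. p j)) = ?f (\<lambda>i. p (r i))" for p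
  proof -
    have 1: "(\<Prod>k<n. \<bar>p k\<bar>) = (\<Prod>k<n. \<bar>p (r k)\<bar>)"
      using prod.permute[OF r, of "\<lambda>k. \<bar>p k\<bar>"] by (simp add: o_def)
    have 2: "(\<Sum>j\<in>{r k..<n}. p j) = (\<Sum>j\<le>k. p (r j))" if "k < n" for k
      by (rule sum.reindex_bij_witness[of _ r r]) (use that in \<open>auto simp: r_def\<close>)
    have "(\<Prod>k<n. h (\<Sum>j\<in>{k..<n}. p j)) = (\<Prod>k<n. h (\<Sum>j\<in>{r k..<n}. p j))"
      using prod.permute[OF r, of "\<lambda>k. h (\<Sum>j\<in>{k..<n}. p j)"] by (simp add: o_def)
    then show ?thesis using 1 2 by simp
  qed
  then have "(\<integral>\<^sup>+ p. ennreal (\<Prod>k<n. \<bar>p k\<bar>) * (\<Prod>k<n. h (\<Sum>j\<in>{k..<n}. p j)) \<partial>lborel_pow n)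
      = (\<integral>\<^sup>+ p. ?f (\<lambda>i. p (r i)) \<partial>lborel_pow n)" by simp
  also have "\<dots> = (\<integral>\<^sup>+ p. ?f p \<partial>lborel_pow n)"
    by (rule nn_integral_permute_coords[OF r f])
       (auto intro!: arg_cong2[where f="(*)"] arg_cong[where f=ennreal] prod.cong arg_cong[where f=h] sum.cong)
  also have "\<dots> \<le> (\<integral>\<^sup>+ p. (\<Prod>k<n. ?g (p k + (\<Sum>j<k. 1 * p j))) \<partial>lborel_pow n)"
  proof (rule nn_integral_mono)
    fix p :: "nat \<Rightarrow> real"
    have "ennreal (\<Prod>k<n. \<bar>p k\<bar>) \<le> ennreal (\<Prod>k<n. (\<rho> + \<bar>\<Sum>j\<le>k. p j\<bar>)\<^sup>2 / \<rho>)"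
      by (intro ennreal_leI prod_abs_le_prod_partial_sums \<rho>)
    also have "\<dots> = (\<Prod>k<n. ennreal ((\<rho> + \<bar>\<Sum>j\<le>k. p j\<bar>)\<^sup>2 / \<rho>))"
      using \<rho> by (intro prod_ennreal[symmetric]) auto
    finally have "?f p \<le> (\<Prod>k<n. ?g (\<Sum>j\<le>k. p j))"
      by (simp add: prod.distrib mult_right_mono)
    moreover have "p k + (\<Sum>j<k. 1 * p j) = (\<Sum>j\<le>k. p j)" for k
      by (simp add: lessThan_Suc_atMost[symmetric])
    ultimately show "?f p \<le> (\<Prod>k<n. ?g (p k + (\<Sum>j<k. 1 * p j)))"
      by (simp only:)
  qed
  also have "\<dots> = (\<Prod>k<n. \<integral>\<^sup>+ w. ?g w \<partial>lborel)"
    by (rule nn_integral_triangular) measurable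
  finally show ?thesis by simp
qed

section \<open>Finite-dimensional characteristic functions of stable processes\<close>

text \<open>Summation by parts: a linear combination of values of a process becomes one of its
  increments \<open>d i\<close>, with the tail sums of \<open>p\<close> as coefficients.\<close>

lemma sum_mult_partial_sums:
  fixes p d :: "nat \<Rightarrow> 'a::comm_semiring_0"
  shows "(\<Sum>k<n. p k * (\<Sum>i\<le>k. d i)) = (\<Sum>i<n. (\<Sum>j\<in>{i..<n}. p j) * d i)"
proof (induction n)
  case (Suc n)
  have "(\<Sum>i<n. (\<Sum>j\<in>{i..<Suc n}. p j) * d i) = (\<Sum>i<n. (\<Sum>j\<in>{i..<n}. p j) * d i + p n * d i)"
    by (intro sum.cong) (auto simp: distrib_right)
  then show ?case
    using Suc by (simp add: sum.distrib sum_distrib_left lessThan_Suc_atMost[symmetric] algebra_simps)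
qed simp

definition fdd_char :: "'a measure \<Rightarrow> (real \<Rightarrow> 'a \<Rightarrow> real) \<Rightarrow> nat \<Rightarrow> (nat \<Rightarrow> real) \<Rightarrow> (nat \<Rightarrow> real) \<Rightarrow> complex"
  where "fdd_char M X n p t = (\<integral>\<omega>. iexp (\<Sum>k<n. p k * X (t k) \<omega>) \<partial>M)"

lemma fdd_char_permute:
  assumes "\<pi> permutes {..<n}"
  shows "fdd_char M X n (p \<circ> \<pi>) (t \<circ> \<pi>) = fdd_char M X n p t"
proof -
  have "(\<Sum>k<n. p (\<pi> k) * X (t (\<pi> k)) \<omega>) = (\<Sum>k<n. p k * X (t k) \<omega>)" for \<omega>
    using sum.permute[OF assms, of "\<lambda>k. p k * X (t k) \<omega>"] by (simp add: o_def)
  then show ?thesis by (simp add: fdd_char_def)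
qed

text \<open>The exponent is rewritten through the increments between consecutive times. Independence
  splits the expectation into a product, and stationarity identifies each factor with the
  characteristic function of \<open>X\<close> at the time gap.\<close>

lemma fdd_char_sym_stable:
  assumes X: "sym_stable_process M \<alpha> \<sigma> X"
    and mono: "\<And>i j. i \<le> j \<Longrightarrow> j < n \<Longrightarrow> t i \<le> t j" and pos: "\<And>i. i < n \<Longrightarrow> 0 \<le> t i"
  shows "fdd_char M X n p t = of_real (\<Prod>k<n. exp (- ((t k - (if k = 0 then 0 else t (k - 1)))
           * (\<sigma> powr \<alpha> * \<bar>\<Sum>j\<in>{k..<n}. p j\<bar> powr \<alpha>))))"
proof (cases "n = 0")
  case True
  interpret prob_space M using X by (simp add: sym_stable_process_def)
  show ?thesis using True prob_space by (simp add: fdd_char_def)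
next
  case False
  interpret prob_space M using X by (simp add: sym_stable_process_def)
  have Xm[measurable]: "X s \<in> borel_measurable M" for s using X by (simp add: sym_stable_process_def)
  \<comment> \<open>Independence of increments is assumed for infinite increasing sequences of
    times. The given times are therefore preceded by 0, which shifts the index by one, and frozen
    after the last of them.\<close>
  define T where "T k = (if k = 0 then 0 else t (min (k - 1) (n - 1)))" for k
  define D where "D k \<omega> = X (T (Suc k)) \<omega> - X (T k) \<omega>" for k \<omega>
  have Dm[measurable]: "D k \<in> borel_measurable M" for k
    unfolding D_def[abs_def] by measurable
  define v where "v k = (\<Sum>j\<in>{k..<n}. p j)" for k
  have inc: "incseq T"
    unfolding T_def by (rule incseq_SucI) (use False in \<open>auto intro!: mono pos\<close>)
  have T_nonneg: "0 \<le> T k" for k using False by (auto simp: T_def intro!: pos)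
  have TSuc: "T (Suc k) = t k" if "k < n" for k using that by (auto simp: T_def min_def)
  have Tdiff: "T (Suc k) - T k = t k - (if k = 0 then 0 else t (k - 1))" if "k < n" for k
    using that by (auto simp: T_def min_def)
  have ind: "indep_vars (\<lambda>_. borel) D UNIV"
    unfolding D_def[abs_def] using X inc T_nonneg[of 0] by (auto simp: sym_stable_process_def)
  then have ind': "indep_vars (\<lambda>_. borel) (\<lambda>k \<omega>. iexp (v k * D k \<omega>)) {..<n}"
    by (intro indep_vars_compose2[where Y="\<lambda>k x. iexp (v k * x)" and X=D and M'="\<lambda>_. borel"]
              indep_vars_subset[OF ind]) auto
  \<comment> \<open>The process starts at 0 only almost surely, so the exponent equals the sum over
    increments only almost surely.\<close>
  have AE0: "AE \<omega> in M. X 0 \<omega> = 0" using X by (simp add: sym_stable_process_def)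
  have eq: "(\<Sum>k<n. p k * X (t k) \<omega>) = (\<Sum>k<n. v k * D k \<omega>)" if "X 0 \<omega> = 0" for \<omega>
  proof -
    have tel: "(\<Sum>i\<le>k. D i \<omega>) = X (T (Suc k)) \<omega>" for k
      using that by (induction k) (simp_all add: D_def T_def)
    have "(\<Sum>k<n. p k * X (t k) \<omega>) = (\<Sum>k<n. p k * (\<Sum>i\<le>k. D i \<omega>))"
      by (intro sum.cong) (simp_all add: tel TSuc)
    then show ?thesis unfolding sum_mult_partial_sums v_def .
  qed
  have "fdd_char M X n p t = (\<integral>\<omega>. (\<Prod>k<n. iexp (v k * D k \<omega>)) \<partial>M)"
    unfolding fdd_char_def
  proof (rule integral_cong_AE)
    show "AE \<omega> in M. iexp (\<Sum>k<n. p k * X (t k) \<omega>) = (\<Prod>k<n. iexp (v k * D k \<omega>))"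
      using AE0 by eventually_elim (simp add: eq exp_sum[symmetric] sum_distrib_left)
  qed simp_all
  also have "\<dots> = (\<Prod>k<n. \<integral>\<omega>. iexp (v k * D k \<omega>) \<partial>M)"
    by (rule indep_vars_lebesgue_integral[OF _ ind'])
       (auto intro!: integrable_const_bound[where B=1])
  also have "\<dots> = (\<Prod>k<n. of_real (exp (- ((t k - (if k = 0 then 0 else t (k - 1)))
           * (\<sigma> powr \<alpha> * \<bar>v k\<bar> powr \<alpha>)))))"
  proof (rule prod.cong[OF refl])
    fix k assume k: "k \<in> {..<n}"
    have le: "T k \<le> T (Suc k)" using inc by (simp add: incseq_SucD)
    have "(\<integral>\<omega>. iexp (v k * D k \<omega>) \<partial>M) = char (distr M borel (D k)) (v k)"
      unfolding char_def by (subst integral_distr) simp_all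
    also have "distr M borel (D k) = distr M borel (X (T (Suc k) - T k))"
      unfolding D_def[abs_def] using X T_nonneg[of k] le by (simp add: sym_stable_process_def)
    also have "char \<dots> (v k) = of_real (exp (- ((T (Suc k) - T k) * \<sigma> powr \<alpha> * \<bar>v k\<bar> powr \<alpha>)))"
      using X le by (simp add: sym_stable_process_def)
    finally show "(\<integral>\<omega>. iexp (v k * D k \<omega>) \<partial>M) = of_real (exp (- ((t k - (if k = 0 then 0 else t (k - 1)))
           * (\<sigma> powr \<alpha> * \<bar>v k\<bar> powr \<alpha>))))"
      using Tdiff k by (simp add: mult.assoc)
  qed
  finally show ?thesis unfolding v_def of_real_prod .
qed

section \<open>Time integrals over the unit cube\<close>

lemma nn_integral_exp_atLeast_0:
  fixes a :: real assumes a: "0 < a"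
  shows "(\<integral>\<^sup>+ u. ennreal (exp (- (u * a))) * indicator {0..} u \<partial>lborel) = ennreal (1 / a)"
proof -
  have lim: "((\<lambda>u. - exp (- (u * a)) / a) \<longlongrightarrow> 0) at_top"
    using a by real_asymp
  have "(\<integral>\<^sup>+ u. ennreal (exp (- (u * a))) * indicator {0..} u \<partial>lborel)
      = ennreal (0 - (- exp (- (0 * a)) / a))"
    by (rule nn_integral_FTC_atLeast[where F="\<lambda>u. - exp (- (u * a)) / a" and T=0, OF _ _ _ lim])
       (use a in \<open>auto intro!: derivative_eq_intros\<close>)
  then show ?thesis by simp
qed

text \<open>Each factor is the Laplace transform at rate \<open>\<kappa>\<close> of the
  characteristic function of a stable process, that is, the symbol of its resolvent. The prefactor
  \<open>exp \<kappa>\<close> is the price for lifting the constraint that the largest time is at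
  most 1.\<close>

definition resolvent_prod :: "real \<Rightarrow> real \<Rightarrow> real \<Rightarrow> nat \<Rightarrow> (nat \<Rightarrow> real) \<Rightarrow> real" where
  "resolvent_prod \<alpha> c \<kappa> n p = exp \<kappa> * (\<Prod>k<n. 1 / (\<kappa> + c * \<bar>\<Sum>j\<in>{k..<n}. p j\<bar> powr \<alpha>))"

text \<open>Where \<open>t (\<pi> i)\<close> increases with \<open>i\<close>, the characteristic
  function is an explicit product over the time gaps. A majorant that no longer restricts the
  largest time lets the gaps range freely over \<open>{0..}\<close>, and each of them contributes
  one resolvent factor.\<close>

lemma nn_integral_fdd_char_le:
  assumes X: "sym_stable_process M \<alpha> \<sigma> X" and \<kappa>: "0 < \<kappa>"
  shows "(\<integral>\<^sup>+ t. ennreal ((\<Prod>k<n. indicator {0<..<1} (t k)) * cmod (fdd_char M X n p t)) \<partial>lborel_pow n)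
    \<le> ennreal (\<Sum>\<pi> | \<pi> permutes {..<n}. resolvent_prod \<alpha> (\<sigma> powr \<alpha>) \<kappa> n (p \<circ> \<pi>))"
proof -
  define P where "P = {\<pi>. \<pi> permutes {..<n}}"
  have finP: "finite P" unfolding P_def by (rule finite_permutations) simp
  define c where "c \<pi> k = \<sigma> powr \<alpha> * \<bar>\<Sum>j\<in>{k..<n}. p (\<pi> j)\<bar> powr \<alpha>" for \<pi> k
  have c: "0 \<le> c \<pi> k" for \<pi> k by (simp add: c_def)
  \<comment> \<open>The coefficients that write the gap between \<open>t k\<close> and its
    predecessor in the form required by \<open>nn_integral_triangular\<close>; the predecessor of
    the first time is 0.\<close>
  define a :: "nat \<Rightarrow> nat \<Rightarrow> real" where "a k j = (if Suc j = k then -1 else 0)" for k j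
  define u where "u t k = t k + (\<Sum>j<k. a k j * t j)" for t k
  have u: "u t k = t k - (if k = 0 then 0 else t (k - 1))" for t k
  proof (cases k)
    case (Suc m)
    have "(\<Sum>j<Suc m. a (Suc m) j * t j) = (\<Sum>j<m. a (Suc m) j * t j) - t m"
      by (simp add: a_def)
    also have "(\<Sum>j<m. a (Suc m) j * t j) = 0" by (rule sum.neutral) (auto simp: a_def)
    finally show ?thesis using Suc by (simp add: u_def)
  qed (simp add: u_def)
  \<comment> \<open>\<open>K\<close> vanishes on negative gaps, so \<open>H \<pi>\<close> is
    supported on increasing times. The rate \<open>\<kappa>\<close> keeps the integral finite even
    where \<open>c \<pi> k\<close> is 0.\<close>
  define K where "K \<pi> k x = ennreal (exp (- (x * (\<kappa> + c \<pi> k)))) * indicator {0..} x" for \<pi> k x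
  have K[measurable]: "K \<pi> k \<in> borel_measurable borel" for \<pi> k
    unfolding K_def[abs_def] by measurable
  define H where "H \<pi> t = ennreal (exp \<kappa>) * (\<Prod>k<n. K \<pi> k (u t k))" for \<pi> t
  have H[measurable]: "H \<pi> \<in> borel_measurable (lborel_pow n)" for \<pi>
    unfolding H_def[abs_def] u_def by measurable
  have Hcong: "H \<pi> x = H \<pi> y" if "\<And>i. i < n \<Longrightarrow> x i = y i" for \<pi> x y
    using that by (auto simp: H_def u_def intro!: arg_cong2[where f="(*)"] prod.cong
       arg_cong[where f="K _ _"] arg_cong2[where f="(+)"] sum.cong)
  have int_H: "(\<integral>\<^sup>+ t. H \<pi> (\<lambda>i. t (\<pi> i)) \<partial>lborel_pow n)
      = ennreal (resolvent_prod \<alpha> (\<sigma> powr \<alpha>) \<kappa> n (p \<circ> \<pi>))" if "\<pi> \<in> P" for \<pi>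
  proof -
    have "(\<integral>\<^sup>+ t. H \<pi> (\<lambda>i. t (\<pi> i)) \<partial>lborel_pow n) = (\<integral>\<^sup>+ t. H \<pi> t \<partial>lborel_pow n)"
      by (rule nn_integral_permute_coords[OF _ H])
         (use that in \<open>auto simp: P_def intro!: Hcong\<close>)
    also have "\<dots> = ennreal (exp \<kappa>) * (\<integral>\<^sup>+ t. (\<Prod>k<n. K \<pi> k (u t k)) \<partial>lborel_pow n)"
      unfolding H_def by (rule nn_integral_cmult) (unfold u_def, measurable)
    also have "(\<integral>\<^sup>+ t. (\<Prod>k<n. K \<pi> k (u t k)) \<partial>lborel_pow n) = (\<Prod>k<n. \<integral>\<^sup>+ x. K \<pi> k x \<partial>lborel)"
      unfolding u_def by (rule nn_integral_triangular) measurable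
    also have "\<dots> = (\<Prod>k<n. ennreal (1 / (\<kappa> + c \<pi> k)))"
      unfolding K_def using \<kappa> c by (intro prod.cong refl nn_integral_exp_atLeast_0) (simp add: add_pos_nonneg)
    also have "\<dots> = ennreal (\<Prod>k<n. 1 / (\<kappa> + c \<pi> k))"
      using \<kappa> c by (intro prod_ennreal) (simp add: add_pos_nonneg less_imp_le)
    finally show ?thesis
      using \<kappa> c by (simp add: resolvent_prod_def c_def ennreal_mult' )
  qed
  have le: "ennreal ((\<Prod>k<n. indicator {0<..<1} (t k)) * cmod (fdd_char M X n p t))
      \<le> (\<Sum>\<pi>\<in>P. H \<pi> (\<lambda>i. t (\<pi> i)))" for t
  proof (cases "\<forall>k<n. t k \<in> {0<..<1}")
    case False
    then obtain k where "k < n" "t k \<notin> {0<..<1}" by blast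
    then have "(\<Prod>k<n. indicator {0<..<1} (t k)) = (0::real)"
      by (intro prod_zero bexI[of _ k]) auto
    then show ?thesis by (simp only: mult_zero_left ennreal_0 zero_le)
  next
    case True
    obtain \<pi> where \<pi>: "\<pi> permutes {..<n}" and sorted: "\<And>i j. i \<le> j \<Longrightarrow> j < n \<Longrightarrow> t (\<pi> i) \<le> t (\<pi> j)"
      using ex_sorting_permutation[of n t] by blast
    define s where "s i = t (\<pi> i)" for i
    have s: "0 < s i" "s i < 1" if "i < n" for i
      using True permutes_in_image[OF \<pi>, of i] that by (auto simp: s_def)
    have u_nonneg: "0 \<le> u s k" if "k < n" for k
      using sorted[of "k - 1" k] s[of k] that by (auto simp: u s_def[symmetric])
    have sum_u: "(\<Sum>k<m. u s k) = (if m = 0 then 0 else s (m - 1))" for m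
      by (induction m) (simp_all add: u)
    have sum_u_le: "(\<Sum>k<n. u s k) \<le> 1" using s[of "n - 1"] by (cases "n = 0") (auto simp: sum_u less_imp_le)
    have "fdd_char M X n p t = fdd_char M X n (p \<circ> \<pi>) (t \<circ> \<pi>)"
      by (rule fdd_char_permute[OF \<pi>, symmetric])
    also have "\<dots> = of_real (\<Prod>k<n. exp (- (u s k * c \<pi> k)))"
      by (subst fdd_char_sym_stable[OF X])
         (use sorted s in \<open>auto simp: s_def[abs_def] u c_def o_def less_imp_le cong: if_cong\<close>)
    finally have "cmod (fdd_char M X n p t) = (\<Prod>k<n. exp (- (u s k * c \<pi> k)))"
      by (simp add: abs_prod del: of_real_prod)
    \<comment> \<open>The gaps add up to the largest time, which is at most 1, so the inserted
      weight is at least 1. Distributed over the gaps, it adds \<open>\<kappa>\<close> to every rate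
      and leaves \<open>exp \<kappa>\<close> in front.\<close>
    also have "\<dots> \<le> exp (\<kappa> * (1 - (\<Sum>k<n. u s k))) * (\<Prod>k<n. exp (- (u s k * c \<pi> k)))"
    proof -
      have "1 \<le> exp (\<kappa> * (1 - (\<Sum>k<n. u s k)))" using \<kappa> sum_u_le by simp
      then show ?thesis
        using mult_right_mono[of 1 _ "\<Prod>k<n. exp (- (u s k * c \<pi> k))"] by (simp add: prod_nonneg)
    qed
    also have "\<dots> = exp \<kappa> * (\<Prod>k<n. exp (- (u s k * (\<kappa> + c \<pi> k))))"
      by (simp add: exp_sum[symmetric] exp_add[symmetric] sum_negf sum.distrib sum_subtractf sum_distrib_left algebra_simps)
    finally have "ennreal (cmod (fdd_char M X n p t)) \<le> ennreal (exp \<kappa> * (\<Prod>k<n. exp (- (u s k * (\<kappa> + c \<pi> k)))))"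
      by (rule ennreal_leI)
    also have "\<dots> = H \<pi> s"
      unfolding H_def K_def using u_nonneg
      by (simp add: ennreal_mult' prod_ennreal[symmetric])
    also have "\<dots> \<le> (\<Sum>\<pi>\<in>P. H \<pi> (\<lambda>i. t (\<pi> i)))"
      using member_le_sum[of \<pi> P "\<lambda>\<pi>. H \<pi> (\<lambda>i. t (\<pi> i))"] \<pi> finP by (simp add: P_def s_def[abs_def])
    finally show ?thesis using True by simp
  qed
  have meas: "(\<lambda>t. H \<pi> (\<lambda>i. t (\<pi> i))) \<in> borel_measurable (lborel_pow n)" if "\<pi> \<in> P" for \<pi>
    by (rule borel_measurable_permute_coords[OF _ H])
       (use that in \<open>auto simp: P_def intro!: Hcong\<close>)
  have "(\<integral>\<^sup>+ t. ennreal ((\<Prod>k<n. indicator {0<..<1} (t k)) * cmod (fdd_char M X n p t)) \<partial>lborel_pow n)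
      \<le> (\<integral>\<^sup>+ t. (\<Sum>\<pi>\<in>P. H \<pi> (\<lambda>i. t (\<pi> i))) \<partial>lborel_pow n)"
    by (intro nn_integral_mono le)
  also have "\<dots> = (\<Sum>\<pi>\<in>P. \<integral>\<^sup>+ t. H \<pi> (\<lambda>i. t (\<pi> i)) \<partial>lborel_pow n)"
    by (rule nn_integral_sum) (rule meas)
  also have "\<dots> = (\<Sum>\<pi>\<in>P. ennreal (resolvent_prod \<alpha> (\<sigma> powr \<alpha>) \<kappa> n (p \<circ> \<pi>)))"
    by (intro sum.cong refl int_H)
  also have "\<dots> = ennreal (\<Sum>\<pi>\<in>P. resolvent_prod \<alpha> (\<sigma> powr \<alpha>) \<kappa> n (p \<circ> \<pi>))"
    using \<kappa> by (intro sum_ennreal)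
      (auto simp: resolvent_prod_def intro!: mult_nonneg_nonneg prod_nonneg add_nonneg_nonneg divide_nonneg_nonneg)
  finally show ?thesis unfolding P_def .
qed

section \<open>The momentum integral\<close>

text \<open>The integrand is bounded near 0 and decays like
  \<open>\<bar>w\<bar> powr (2 - 2 * \<alpha>)\<close> at infinity, which is integrable exactly when
  \<open>\<alpha> > 3/2\<close>.\<close>

lemma resolvent_integral_finite:
  fixes \<alpha> c :: real
  assumes \<alpha>: "3/2 < \<alpha>" and c: "0 < c"
  shows "(\<integral>\<^sup>+ w. ennreal ((1 + \<bar>w\<bar>)\<^sup>2 / (1 + c * \<bar>w\<bar> powr \<alpha>)\<^sup>2) \<partial>lborel) < \<infinity>"
proof -
  \<comment> \<open>For \<open>\<bar>w\<bar> \<ge> 1\<close> the numerator is at most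
    \<open>(2 * \<bar>w\<bar>)^2\<close>, and dropping the 1 in the denominator leaves
    \<open>g \<bar>w\<bar>\<close>.\<close>
  define g where "g w = 4 / c\<^sup>2 * w powr (2 - 2 * \<alpha>)" for w :: real
  have gm[measurable]: "g \<in> borel_measurable borel" unfolding g_def[abs_def] by measurable
  have "((\<lambda>w. w powr (3 - 2 * \<alpha>)) \<longlongrightarrow> 0) at_top"
    using \<alpha> by (intro tendsto_neg_powr filterlim_ident) auto
  then have lim: "((\<lambda>w. 4 / c\<^sup>2 * (w powr (3 - 2 * \<alpha>) / (3 - 2 * \<alpha>))) \<longlongrightarrow> 4 / c\<^sup>2 * (0 / (3 - 2 * \<alpha>))) at_top"
    by (intro tendsto_intros) (use \<alpha> in auto)
  have I1: "(\<integral>\<^sup>+ w. ennreal (g w) * indicator {1..} w \<partial>lborel) < \<infinity>"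
  proof (subst nn_integral_FTC_atLeast[OF gm _ _ lim])
    fix x :: real assume x: "1 \<le> x"
    have "((\<lambda>w. w powr (3 - 2 * \<alpha>) / (3 - 2 * \<alpha>)) has_real_derivative x powr (2 - 2 * \<alpha>)) (at x)"
      using x \<alpha> by (auto intro!: derivative_eq_intros)
    then show "((\<lambda>w. 4 / c\<^sup>2 * (w powr (3 - 2 * \<alpha>) / (3 - 2 * \<alpha>))) has_real_derivative g x) (at x)"
      unfolding g_def by (rule DERIV_cmult)
  qed (simp_all add: g_def)
  have I2: "(\<integral>\<^sup>+ w. ennreal (g (- w)) * indicator {1..} (- w) \<partial>lborel) < \<infinity>"
    using I1 nn_integral_real_affine[of "\<lambda>w. ennreal (g w) * indicator {1..} w" "-1" 0] by simp
  have le: "ennreal ((1 + \<bar>w\<bar>)\<^sup>2 / (1 + c * \<bar>w\<bar> powr \<alpha>)\<^sup>2) \<le>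
      4 * indicator {-1..1} w + (ennreal (g w) * indicator {1..} w + ennreal (g (- w)) * indicator {1..} (- w))" for w
  proof (cases "\<bar>w\<bar> < 1")
    case True
    have "1 \<le> (1 + c * \<bar>w\<bar> powr \<alpha>)\<^sup>2" using c by (intro one_le_power) simp
    moreover have "(1 + \<bar>w\<bar>)\<^sup>2 \<le> 2\<^sup>2" using True by (intro power_mono) auto
    ultimately have "(1 + \<bar>w\<bar>)\<^sup>2 / (1 + c * \<bar>w\<bar> powr \<alpha>)\<^sup>2 \<le> 4 / 1" by (intro frac_le) auto
    then have "ennreal ((1 + \<bar>w\<bar>)\<^sup>2 / (1 + c * \<bar>w\<bar> powr \<alpha>)\<^sup>2) \<le> ennreal 4" by (intro ennreal_leI) simp
    then show ?thesis using True by (auto simp: indicator_def)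
  next
    case False
    have "(1 + \<bar>w\<bar>)\<^sup>2 / (1 + c * \<bar>w\<bar> powr \<alpha>)\<^sup>2 \<le> (2 * \<bar>w\<bar>)\<^sup>2 / (c * \<bar>w\<bar> powr \<alpha>)\<^sup>2"
      using False c by (intro frac_le power_mono zero_less_power mult_pos_pos) auto
    also have "\<dots> = g \<bar>w\<bar>"
    proof -
      have "\<bar>w\<bar> powr (2 - 2 * \<alpha>) = \<bar>w\<bar> powr 2 / (\<bar>w\<bar> powr \<alpha>)\<^sup>2"
        using False by (subst powr_diff) (simp add: powr_power mult.commute)
      then show ?thesis using False by (simp add: g_def power_mult_distrib)
    qed
    finally have "ennreal ((1 + \<bar>w\<bar>)\<^sup>2 / (1 + c * \<bar>w\<bar> powr \<alpha>)\<^sup>2) \<le> ennreal (g \<bar>w\<bar>)"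
      by (rule ennreal_leI)
    also have "\<dots> \<le> ennreal (g w) * indicator {1..} w + ennreal (g (- w)) * indicator {1..} (- w)"
      using False by (auto simp: indicator_def abs_if)
    finally show ?thesis by (rule order_trans) simp
  qed
  have "(\<integral>\<^sup>+ w. ennreal ((1 + \<bar>w\<bar>)\<^sup>2 / (1 + c * \<bar>w\<bar> powr \<alpha>)\<^sup>2) \<partial>lborel)
      \<le> (\<integral>\<^sup>+ w. 4 * indicator {-1..1} w + (ennreal (g w) * indicator {1..} w + ennreal (g (- w)) * indicator {1..} (- w)) \<partial>lborel)"
    by (intro nn_integral_mono le)
  also have "\<dots> = 4 * emeasure lborel {-1..1::real} + ((\<integral>\<^sup>+ w. ennreal (g w) * indicator {1..} w \<partial>lborel)
      + (\<integral>\<^sup>+ w. ennreal (g (- w)) * indicator {1..} (- w) \<partial>lborel))"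
    by (subst nn_integral_add, measurable, subst nn_integral_add, measurable) (simp add: nn_integral_cmult)
  also have "\<dots> < \<infinity>" using I1 I2 by (simp add: ennreal_mult_less_top)
  finally show ?thesis .
qed

text \<open>Substitute \<open>w = \<rho> * x\<close>, where
  \<open>\<rho> powr \<alpha> = \<kappa>\<close>. The bracket in the numerator yields a factor
  \<open>\<rho>\<close>, the one in the denominator a factor \<open>\<kappa>\<close>, each squared,
  and the Jacobian cancels the division by \<open>\<rho>\<close>.\<close>

lemma resolvent_integral_scale:
  fixes \<alpha> c \<kappa> :: real
  assumes \<alpha>: "0 < \<alpha>" and c: "0 < c" and \<kappa>: "0 < \<kappa>"
  defines "\<rho> \<equiv> \<kappa> powr (1 / \<alpha>)"
  shows "(\<integral>\<^sup>+ w. ennreal ((\<rho> + \<bar>w\<bar>)\<^sup>2 / \<rho>) * ennreal ((1 / (\<kappa> + c * \<bar>w\<bar> powr \<alpha>))\<^sup>2) \<partial>lborel)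
     = ennreal (\<kappa> powr (2 / \<alpha> - 2)) * (\<integral>\<^sup>+ w. ennreal ((1 + \<bar>w\<bar>)\<^sup>2 / (1 + c * \<bar>w\<bar> powr \<alpha>)\<^sup>2) \<partial>lborel)"
proof -
  have \<rho>: "0 < \<rho>" using \<kappa> by (simp add: \<rho>_def)
  have \<rho>\<alpha>: "\<rho> powr \<alpha> = \<kappa>" using \<kappa> \<alpha> by (simp add: \<rho>_def powr_powr)
  have \<rho>2: "\<rho>\<^sup>2 / \<kappa>\<^sup>2 = \<kappa> powr (2 / \<alpha> - 2)"
    using \<kappa> by (simp add: \<rho>_def powr_diff powr_power)
  have pt: "\<rho> * ((\<rho> + \<bar>\<rho> * x\<bar>)\<^sup>2 / \<rho> * (1 / (\<kappa> + c * \<bar>\<rho> * x\<bar> powr \<alpha>))\<^sup>2)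
      = \<rho>\<^sup>2 / \<kappa>\<^sup>2 * ((1 + \<bar>x\<bar>)\<^sup>2 / (1 + c * \<bar>x\<bar> powr \<alpha>)\<^sup>2)" for x
  proof -
    have 1: "\<rho> + \<bar>\<rho> * x\<bar> = \<rho> * (1 + \<bar>x\<bar>)" using \<rho> by (simp add: abs_mult algebra_simps)
    have 2: "\<kappa> + c * \<bar>\<rho> * x\<bar> powr \<alpha> = \<kappa> * (1 + c * \<bar>x\<bar> powr \<alpha>)"
      using \<rho> \<rho>\<alpha> by (simp add: abs_mult powr_mult algebra_simps)
    show ?thesis unfolding 1 2 using \<rho> \<kappa> by (simp add: power_mult_distrib power_divide)
  qed
  have "(\<integral>\<^sup>+ w. ennreal ((\<rho> + \<bar>w\<bar>)\<^sup>2 / \<rho>) * ennreal ((1 / (\<kappa> + c * \<bar>w\<bar> powr \<alpha>))\<^sup>2) \<partial>lborel)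
    = (\<integral>\<^sup>+ w. ennreal ((\<rho> + \<bar>w\<bar>)\<^sup>2 / \<rho> * (1 / (\<kappa> + c * \<bar>w\<bar> powr \<alpha>))\<^sup>2) \<partial>lborel)"
    by (intro nn_integral_cong ennreal_mult'[symmetric]) (use \<rho> in simp)
  also have "\<dots> = ennreal \<rho> * (\<integral>\<^sup>+ x. ennreal ((\<rho> + \<bar>\<rho> * x\<bar>)\<^sup>2 / \<rho> * (1 / (\<kappa> + c * \<bar>\<rho> * x\<bar> powr \<alpha>))\<^sup>2) \<partial>lborel)"
    using \<rho> by (subst nn_integral_real_affine[where c=\<rho> and t=0]) auto
  also have "\<dots> = (\<integral>\<^sup>+ x. ennreal (\<rho> * ((\<rho> + \<bar>\<rho> * x\<bar>)\<^sup>2 / \<rho> * (1 / (\<kappa> + c * \<bar>\<rho> * x\<bar> powr \<alpha>))\<^sup>2)) \<partial>lborel)"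
    unfolding ennreal_mult'[OF less_imp_le[OF \<rho>]] by (rule nn_integral_cmult[symmetric]) measurable
  also have "\<dots> = (\<integral>\<^sup>+ x. ennreal (\<kappa> powr (2 / \<alpha> - 2)) * ennreal ((1 + \<bar>x\<bar>)\<^sup>2 / (1 + c * \<bar>x\<bar> powr \<alpha>)\<^sup>2) \<partial>lborel)"
    unfolding pt \<rho>2 by (intro nn_integral_cong ennreal_mult') simp
  also have "\<dots> = ennreal (\<kappa> powr (2 / \<alpha> - 2)) * (\<integral>\<^sup>+ x. ennreal ((1 + \<bar>x\<bar>)\<^sup>2 / (1 + c * \<bar>x\<bar> powr \<alpha>)\<^sup>2) \<partial>lborel)"
    by (rule nn_integral_cmult) measurable
  finally show ?thesis .
qed

text \<open>By Cauchy-Schwarz the square of a sum over \<open>fact n\<close> permutations is at most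
  \<open>fact n\<close> times the sum of squares. All the squares have the same integral, because
  the weight is symmetric in the momenta; this gives the second \<open>fact n\<close>.\<close>

lemma nn_integral_resolvent_sum_square_le:
  fixes \<alpha> c \<kappa> :: real
  assumes \<alpha>: "0 < \<alpha>" and c: "0 < c" and \<kappa>: "0 < \<kappa>"
  shows "(\<integral>\<^sup>+ p. ennreal (\<Prod>k<n. \<bar>p k\<bar>) *
        (ennreal (\<Sum>\<pi> | \<pi> permutes {..<n}. resolvent_prod \<alpha> c \<kappa> n (p \<circ> \<pi>)))\<^sup>2 \<partial>lborel_pow n)
      \<le> ennreal ((fact n)\<^sup>2 * (exp \<kappa>)\<^sup>2) * (ennreal (\<kappa> powr (2 / \<alpha> - 2)) *
          (\<integral>\<^sup>+ w. ennreal ((1 + \<bar>w\<bar>)\<^sup>2 / (1 + c * \<bar>w\<bar> powr \<alpha>)\<^sup>2) \<partial>lborel)) ^ n"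
    (is "_ \<le> _ * ?J ^ n")
proof -
  define P where "P = {\<pi>. \<pi> permutes {..<n}}"
  have finP: "finite P" unfolding P_def by (rule finite_permutations) simp
  have cardP: "real (card P) = fact n"
    unfolding P_def using card_permutations[of "{..<n}" n] by simp
  define h where "h w = ennreal ((1 / (\<kappa> + c * \<bar>w\<bar> powr \<alpha>))\<^sup>2)" for w
  have hm[measurable]: "h \<in> borel_measurable borel" unfolding h_def[abs_def] by measurable
  let ?s = "resolvent_prod \<alpha> c \<kappa> n"
  define f where "f p = ennreal (\<Prod>k<n. \<bar>p k\<bar>) * (\<Prod>k<n. h (\<Sum>j\<in>{k..<n}. p j))" for p
  have fm[measurable]: "f \<in> borel_measurable (lborel_pow n)"
    unfolding f_def[abs_def] by measurable
  have fcong: "f x = f y" if "\<And>i. i < n \<Longrightarrow> x i = y i" for x y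
    using that by (auto simp: f_def intro!: arg_cong2[where f="(*)"] prod.cong
       arg_cong[where f=h] sum.cong arg_cong[where f=ennreal])
  have s_nonneg: "0 \<le> ?s p" for p
    using \<kappa> c by (auto simp: resolvent_prod_def intro!: mult_nonneg_nonneg prod_nonneg add_nonneg_nonneg divide_nonneg_nonneg)
  have f_eq: "ennreal (\<Prod>k<n. \<bar>p k\<bar>) * ennreal ((?s (p \<circ> \<pi>))\<^sup>2) = ennreal ((exp \<kappa>)\<^sup>2) * f (\<lambda>i. p (\<pi> i))"
    if "\<pi> \<in> P" for p \<pi>
  proof -
    have 1: "(\<Prod>k<n. \<bar>p k\<bar>) = (\<Prod>k<n. \<bar>p (\<pi> k)\<bar>)"
      using prod.permute[of \<pi> "{..<n}" "\<lambda>k. \<bar>p k\<bar>"] that by (simp add: o_def P_def)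
    have "ennreal ((?s (p \<circ> \<pi>))\<^sup>2)
        = ennreal ((exp \<kappa>)\<^sup>2 * (\<Prod>k<n. (1 / (\<kappa> + c * \<bar>\<Sum>j\<in>{k..<n}. p (\<pi> j)\<bar> powr \<alpha>))\<^sup>2))"
      by (simp add: resolvent_prod_def power_mult_distrib prod_power_distrib[symmetric])
    also have "\<dots> = ennreal ((exp \<kappa>)\<^sup>2) * (\<Prod>k<n. h (\<Sum>j\<in>{k..<n}. p (\<pi> j)))"
      unfolding h_def by (subst prod_ennreal) (simp_all add: ennreal_mult')
    finally show ?thesis unfolding f_def using 1 by (simp add: mult_ac)
  qed
  have le: "ennreal (\<Prod>k<n. \<bar>p k\<bar>) * (ennreal (\<Sum>\<pi>\<in>P. ?s (p \<circ> \<pi>)))\<^sup>2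
      \<le> ennreal (fact n * (exp \<kappa>)\<^sup>2) * (\<Sum>\<pi>\<in>P. f (\<lambda>i. p (\<pi> i)))" for p
  proof -
    have "(ennreal (\<Sum>\<pi>\<in>P. ?s (p \<circ> \<pi>)))\<^sup>2 = ennreal ((\<Sum>\<pi>\<in>P. ?s (p \<circ> \<pi>))\<^sup>2)"
      by (rule ennreal_power) (intro sum_nonneg s_nonneg)
    also have "\<dots> \<le> ennreal (fact n * (\<Sum>\<pi>\<in>P. (?s (p \<circ> \<pi>))\<^sup>2))"
      using sum_squared_le_sum_of_squares[of "\<lambda>\<pi>. ?s (p \<circ> \<pi>)" P] cardP
      by (intro ennreal_leI) (simp add: mult.commute)
    also have "\<dots> = ennreal (fact n) * (\<Sum>\<pi>\<in>P. ennreal ((?s (p \<circ> \<pi>))\<^sup>2))"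
      by (subst sum_ennreal) (simp_all add: ennreal_mult')
    finally have "ennreal (\<Prod>k<n. \<bar>p k\<bar>) * (ennreal (\<Sum>\<pi>\<in>P. ?s (p \<circ> \<pi>)))\<^sup>2
        \<le> ennreal (\<Prod>k<n. \<bar>p k\<bar>) * (ennreal (fact n) * (\<Sum>\<pi>\<in>P. ennreal ((?s (p \<circ> \<pi>))\<^sup>2)))"
      by (rule mult_left_mono) simp
    also have "\<dots> = ennreal (fact n) * (\<Sum>\<pi>\<in>P. ennreal (\<Prod>k<n. \<bar>p k\<bar>) * ennreal ((?s (p \<circ> \<pi>))\<^sup>2))"
      by (simp only: sum_distrib_left[symmetric] mult_ac)
    also have "\<dots> = ennreal (fact n) * (\<Sum>\<pi>\<in>P. ennreal ((exp \<kappa>)\<^sup>2) * f (\<lambda>i. p (\<pi> i)))"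
      by (simp add: f_eq cong: sum.cong)
    also have "\<dots> = ennreal (fact n * (exp \<kappa>)\<^sup>2) * (\<Sum>\<pi>\<in>P. f (\<lambda>i. p (\<pi> i)))"
      by (simp add: sum_distrib_left mult_ac ennreal_mult')
    finally show ?thesis .
  qed
  have fpm: "(\<lambda>p. f (\<lambda>i. p (\<pi> i))) \<in> borel_measurable (lborel_pow n)" if "\<pi> \<in> P" for \<pi>
    by (rule borel_measurable_permute_coords[OF _ fm])
       (use that in \<open>auto simp: P_def intro!: fcong\<close>)
  have fint: "(\<integral>\<^sup>+ p. f (\<lambda>i. p (\<pi> i)) \<partial>lborel_pow n) \<le> ?J ^ n" if "\<pi> \<in> P" for \<pi>
  proof -
    have "(\<integral>\<^sup>+ p. f (\<lambda>i. p (\<pi> i)) \<partial>lborel_pow n) = (\<integral>\<^sup>+ p. f p \<partial>lborel_pow n)"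
      by (rule nn_integral_permute_coords[OF _ fm])
         (use that in \<open>auto simp: P_def intro!: fcong\<close>)
    also have "\<dots> \<le> (\<integral>\<^sup>+ w. ennreal ((\<kappa> powr (1 / \<alpha>) + \<bar>w\<bar>)\<^sup>2 / \<kappa> powr (1 / \<alpha>)) * h w \<partial>lborel) ^ n"
      unfolding f_def by (rule nn_integral_prod_abs_tail_sums_le[OF hm]) (use \<kappa> in simp)
    also have "\<dots> = ?J ^ n"
      unfolding h_def using resolvent_integral_scale[OF assms] by simp
    finally show ?thesis .
  qed
  have "(\<integral>\<^sup>+ p. ennreal (\<Prod>k<n. \<bar>p k\<bar>) * (ennreal (\<Sum>\<pi>\<in>P. ?s (p \<circ> \<pi>)))\<^sup>2 \<partial>lborel_pow n)
      \<le> (\<integral>\<^sup>+ p. ennreal (fact n * (exp \<kappa>)\<^sup>2) * (\<Sum>\<pi>\<in>P. f (\<lambda>i. p (\<pi> i))) \<partial>lborel_pow n)"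
    by (intro nn_integral_mono le)
  also have "\<dots> = ennreal (fact n * (exp \<kappa>)\<^sup>2) * (\<integral>\<^sup>+ p. (\<Sum>\<pi>\<in>P. f (\<lambda>i. p (\<pi> i))) \<partial>lborel_pow n)"
    by (rule nn_integral_cmult) (intro borel_measurable_sum fpm)
  also have "\<dots> \<le> ennreal (fact n * (exp \<kappa>)\<^sup>2) * (ennreal (fact n) * ?J ^ n)"
  proof (rule mult_left_mono)
    have "(\<integral>\<^sup>+ p. (\<Sum>\<pi>\<in>P. f (\<lambda>i. p (\<pi> i))) \<partial>lborel_pow n)
        = (\<Sum>\<pi>\<in>P. \<integral>\<^sup>+ p. f (\<lambda>i. p (\<pi> i)) \<partial>lborel_pow n)"
      by (rule nn_integral_sum) (rule fpm)
    also have "\<dots> \<le> (\<Sum>\<pi>\<in>P. ?J ^ n)" by (intro sum_mono fint)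
    also have "\<dots> = ennreal (fact n) * ?J ^ n"
      by (simp add: cardP[symmetric] ennreal_of_nat_eq_real_of_nat)
    finally show "(\<integral>\<^sup>+ p. (\<Sum>\<pi>\<in>P. f (\<lambda>i. p (\<pi> i))) \<partial>lborel_pow n) \<le> ennreal (fact n) * ?J ^ n" .
  qed simp
  also have "\<dots> = ennreal ((fact n)\<^sup>2 * (exp \<kappa>)\<^sup>2) * ?J ^ n"
    by (simp add: ennreal_mult' power2_eq_square mult_ac)
  finally show ?thesis unfolding P_def .
qed

section \<open>The regularized integral along fixed paths\<close>

text \<open>The argument is truncated at 0 because \<open>cadlag_path\<close> says nothing about negative times.\<close>

lemma cadlag_jointly_measurable:
  fixes X :: "real \<Rightarrow> 'a \<Rightarrow> real"
  assumes X[measurable]: "\<And>t. X t \<in> borel_measurable M"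
    and cadlag: "\<And>\<omega>. \<omega> \<in> space M \<Longrightarrow> cadlag_path (\<lambda>t. X t \<omega>)"
  shows "(\<lambda>(t, \<omega>). X (max 0 t) \<omega>) \<in> borel_measurable (borel \<Otimes>\<^sub>M M)"
proof -
  \<comment> \<open>Approximation of \<open>max 0 t\<close> from the right by countably many values,
    which reduces measurability to fixed times. The added 1 makes the inequality strict, so the
    limit is taken within \<open>at_right\<close>, where right continuity applies.\<close>
  define r where "r n t = (of_int \<lfloor>max 0 t * real (Suc n)\<rfloor> + 1) / real (Suc n)" for n t
  have "(\<lambda>z. X (max 0 (fst z)) (snd z)) \<in> borel_measurable (borel \<Otimes>\<^sub>M M)"
  proof (rule borel_measurable_LIMSEQ_real)
    fix n
    show "(\<lambda>z. X (r n (fst z)) (snd z)) \<in> borel_measurable (borel \<Otimes>\<^sub>M M)"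
      unfolding r_def
      by (rule measurable_compose_countable[where g="\<lambda>z. \<lfloor>max 0 (fst z) * real (Suc n)\<rfloor>"
            and f="\<lambda>i z. X ((of_int i + 1) / real (Suc n)) (snd z)"]) measurable
  next
    fix z :: "real \<times> 'a" assume z: "z \<in> space (borel \<Otimes>\<^sub>M M)"
    define \<tau> where "\<tau> = max 0 (fst z)"
    have gt: "\<tau> < r n (fst z)" for n
      unfolding r_def \<tau>_def by (subst pos_less_divide_eq) linarith+
    have le: "r n (fst z) \<le> \<tau> + 1 / real (Suc n)" for n
      unfolding r_def \<tau>_def by (subst pos_divide_le_eq) (simp_all add: distrib_right del: of_nat_Suc)
    have "(\<lambda>n. \<tau> + 1 / real (Suc n)) \<longlonglongrightarrow> \<tau>"
      using LIMSEQ_inverse_real_of_nat_add[of \<tau>] by (simp add: inverse_eq_divide)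
    then have "(\<lambda>n. r n (fst z)) \<longlonglongrightarrow> \<tau>"
      by (rule real_tendsto_sandwich[OF _ _ tendsto_const, rotated 2])
         (use gt le in \<open>auto intro: always_eventually less_imp_le\<close>)
    moreover have "r n (fst z) \<noteq> \<tau>" for n using gt[of n] by simp
    ultimately have lim: "filterlim (\<lambda>n. r n (fst z)) (at_right \<tau>) sequentially"
      using gt by (simp add: filterlim_at)
    have "((\<lambda>t. X t (snd z)) \<longlongrightarrow> X \<tau> (snd z)) (at_right \<tau>)"
      using cadlag[of "snd z"] z by (auto simp: cadlag_path_def space_pair_measure \<tau>_def)
    from filterlim_compose[OF this lim]
    show "(\<lambda>n. X (r n (fst z)) (snd z)) \<longlonglongrightarrow> X (max 0 (fst z)) (snd z)"
      by (simp add: \<tau>_def)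
  qed
  then show ?thesis by (simp add: case_prod_beta')
qed

section \<open>Fubini bounds on product measures\<close>

lemma integrable_pair_bound:
  fixes f :: "'a \<times> 'b \<Rightarrow> 'c::{banach, second_countable_topology}"
  assumes "sigma_finite_measure B" and f[measurable]: "f \<in> borel_measurable (A \<Otimes>\<^sub>M B)"
    and u: "integrable A u" and v: "integrable B v"
    and bound: "\<And>x y. norm (f (x, y)) \<le> u x * v y"
    and nonneg: "\<And>x. 0 \<le> (u x :: real)" "\<And>y. 0 \<le> v y"
  shows "integrable (A \<Otimes>\<^sub>M B) f"
proof (rule integrableI_bounded[OF f])
  interpret B: sigma_finite_measure B by fact
  have [measurable]: "u \<in> borel_measurable A" "v \<in> borel_measurable B" using u v by simp_all
  have "(\<integral>\<^sup>+ z. norm (f z) \<partial>(A \<Otimes>\<^sub>M B)) = (\<integral>\<^sup>+ x. (\<integral>\<^sup>+ y. norm (f (x, y)) \<partial>B) \<partial>A)"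
    by (rule B.nn_integral_fst[symmetric]) measurable
  also have "\<dots> \<le> (\<integral>\<^sup>+ x. (\<integral>\<^sup>+ y. ennreal (u x) * ennreal (v y) \<partial>B) \<partial>A)"
    using nonneg by (intro nn_integral_mono) (auto simp: ennreal_mult'[symmetric] intro!: ennreal_leI bound)
  also have "\<dots> = (\<integral>\<^sup>+ x. ennreal (u x) \<partial>A) * (\<integral>\<^sup>+ y. ennreal (v y) \<partial>B)"
    by (simp add: nn_integral_cmult nn_integral_multc)
  also have "\<dots> < \<infinity>"
    using u v nonneg by (simp add: nn_integral_eq_integral ennreal_mult_less_top)
  finally show "(\<integral>\<^sup>+ z. norm (f z) \<partial>(A \<Otimes>\<^sub>M B)) < \<infinity>" .
qed

text \<open>Fubini followed by the triangle inequality in \<open>x\<close> alone. The norm is taken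
  after the integration over \<open>y\<close>, so cancellation in \<open>y\<close> is kept; with
  \<open>y\<close> the random outcome, this is what leaves characteristic functions inside the
  bound.\<close>

lemma norm_integral_swap_le:
  fixes f :: "'a \<times> 'b \<Rightarrow> 'c::{banach, second_countable_topology}"
  assumes "sigma_finite_measure A" and "sigma_finite_measure B"
    and f: "integrable (A \<Otimes>\<^sub>M B) f"
  shows "ennreal (norm (\<integral>y. (\<integral>x. f (x, y) \<partial>A) \<partial>B)) \<le> (\<integral>\<^sup>+ x. norm (\<integral>y. f (x, y) \<partial>B) \<partial>A)"
proof -
  interpret A: sigma_finite_measure A by fact
  interpret B: sigma_finite_measure B by fact
  interpret AB: pair_sigma_finite A B ..
  have "(\<integral>y. (\<integral>x. f (x, y) \<partial>A) \<partial>B) = (\<integral>x. (\<integral>y. f (x, y) \<partial>B) \<partial>A)"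
    using AB.Fubini_integral[of "\<lambda>x y. f (x, y)"] f by simp
  moreover have "integrable A (\<lambda>x. \<integral>y. f (x, y) \<partial>B)"
    by (rule AB.integrable_fst'[OF f])
  ultimately show ?thesis using integral_norm_bound_ennreal by metis
qed

section \<open>Gaussian weights and Fourier transforms of occupation measures\<close>

definition gauss_weight :: "real \<Rightarrow> real \<Rightarrow> real" where
  "gauss_weight \<epsilon> p = p * exp (- \<epsilon> * p\<^sup>2 / 2)"

lemma borel_measurable_gauss_weight[measurable]: "gauss_weight \<epsilon> \<in> borel_measurable borel"
  unfolding gauss_weight_def[abs_def] by measurable

lemma integrable_gauss_weight:
  assumes "0 < \<epsilon>"
  shows "integrable lborel (gauss_weight \<epsilon>)"
proof -
  \<comment> \<open>Up to its normalising constant, the Gaussian damping is the normal density of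
    variance \<open>1 / \<epsilon>\<close>, so integrability is that of the first moment.\<close>
  have "integrable lborel (\<lambda>p. sqrt (2 * pi * (1 / sqrt \<epsilon>)\<^sup>2) * (normal_density 0 (1 / sqrt \<epsilon>) p * (p - 0) ^ 1))"
    using assms by (intro integrable_mult_right integrable_normal_moment) simp
  also have "(\<lambda>p. sqrt (2 * pi * (1 / sqrt \<epsilon>)\<^sup>2) * (normal_density 0 (1 / sqrt \<epsilon>) p * (p - 0) ^ 1)) = gauss_weight \<epsilon>"
    using assms by (auto simp: normal_density_def gauss_weight_def field_simps)
  finally show ?thesis .
qed

lemma abs_gauss_weight_le: "0 \<le> \<epsilon> \<Longrightarrow> \<bar>gauss_weight \<epsilon> p\<bar> \<le> \<bar>p\<bar>"
  by (simp add: gauss_weight_def abs_mult mult_left_le)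

text \<open>The Fourier transform of the occupation measure of the path \<open>x\<close> on the unit
  time interval.\<close>

definition occ_fourier :: "(real \<Rightarrow> real) \<Rightarrow> real \<Rightarrow> complex" where
  "occ_fourier x p = (\<integral>t. indicator {0<..<1} t *\<^sub>R iexp (p * x t) \<partial>lborel)"

lemma interval_integral_0_1:
  "(CLBINT t=0..1. f t) = (\<integral>t. indicator {0<..<1} t *\<^sub>R f t \<partial>lborel)"
  by (simp add: interval_lebesgue_integral_def set_lebesgue_integral_def zero_ereal_def one_ereal_def)

lemma integrable_occ:
  assumes [measurable]: "x \<in> borel_measurable borel"
  shows "integrable lborel (\<lambda>t. indicator {0<..<1::real} t *\<^sub>R iexp (p * x t))"
proof (rule Bochner_Integration.integrable_bound)
  show "integrable lborel (\<lambda>t. indicator {0<..<1::real} t :: real)" by simp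
qed (auto simp: indicator_def)

lemma norm_occ_fourier_le: "norm (occ_fourier x p) \<le> 1"
proof -
  have "norm (occ_fourier x p) \<le> (\<integral>t. norm (indicator {0<..<1} t *\<^sub>R iexp (p * x t)) \<partial>lborel)"
    unfolding occ_fourier_def by (rule integral_norm_bound)
  also have "\<dots> = (\<integral>t. indicator {0<..<1::real} t \<partial>lborel)"
    by (intro Bochner_Integration.integral_cong) (auto simp: indicator_def)
  finally show ?thesis by simp
qed

lemma occ_fourier_measurable[measurable]:
  assumes [measurable]: "x \<in> borel_measurable borel"
  shows "occ_fourier x \<in> borel_measurable borel"
  unfolding occ_fourier_def[abs_def] by measurable

lemma integral_occ_swap:
  fixes g :: "real \<Rightarrow> complex"
  assumes x[measurable]: "x \<in> borel_measurable borel" and g: "integrable lborel g"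
  shows "(\<integral>t. indicator {0<..<1} t *\<^sub>R (\<integral>p. g p * iexp (p * x t) \<partial>lborel) \<partial>lborel)
      = (\<integral>p. g p * occ_fourier x p \<partial>lborel)"
proof -
  have [measurable]: "g \<in> borel_measurable borel" using g by auto
  let ?f = "\<lambda>p t. g p * (indicator {0<..<1} t *\<^sub>R iexp (p * x t))"
  have "integrable (lborel \<Otimes>\<^sub>M lborel) (case_prod ?f)"
    by (rule integrable_pair_bound[where u="\<lambda>p. norm (g p)" and v="indicator {0<..<1}"])
       (use g in \<open>auto simp: norm_mult indicator_def lborel.sigma_finite_measure_axioms\<close>)
  from lborel_pair.Fubini_integral[OF this]
  have "(\<integral>t. (\<integral>p. ?f p t \<partial>lborel) \<partial>lborel) = (\<integral>p. (\<integral>t. ?f p t \<partial>lborel) \<partial>lborel)" .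
  moreover have "(\<integral>p. ?f p t \<partial>lborel) = indicator {0<..<1} t *\<^sub>R (\<integral>p. g p * iexp (p * x t) \<partial>lborel)" for t
    by (simp add: indicator_def)
  moreover have "(\<integral>t. ?f p t \<partial>lborel) = g p * occ_fourier x p" for p
    unfolding occ_fourier_def by (rule integral_mult_right_zero)
  ultimately show ?thesis by simp
qed

text \<open>The exponential of a difference is a product, so integrating out \<open>s\<close> and
  then \<open>t\<close> by Fubini leaves one momentum integral over two occupation transforms. The
  path \<open>y\<close> enters with a sign because it is subtracted.\<close>

lemma regularized_integral_eq:
  assumes [measurable]: "x \<in> borel_measurable borel" "y \<in> borel_measurable borel" and \<epsilon>: "0 < \<epsilon>"
  shows "(CLBINT t=0..1. (CLBINT s=0..1. (CLBINT p.
        complex_of_real p * iexp (p * (x t - y s)) * complex_of_real (exp (- \<epsilon> * p\<^sup>2 / 2)))))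
     = (\<integral>p. of_real (gauss_weight \<epsilon> p) * occ_fourier x p * occ_fourier (\<lambda>s. - y s) p \<partial>lborel)"
proof -
  let ?a = "\<lambda>p. complex_of_real (gauss_weight \<epsilon> p)"
  have a: "integrable lborel ?a" using integrable_gauss_weight[OF \<epsilon>] by simp
  have y': "(\<lambda>s. - y s) \<in> borel_measurable borel" by measurable
  have b: "integrable lborel (\<lambda>p. ?a p * occ_fourier (\<lambda>s. - y s) p)"
    by (rule Bochner_Integration.integrable_bound[OF a])
       (use norm_occ_fourier_le in \<open>auto simp: norm_mult mult_left_le y'\<close>)
  have e: "iexp (p * (u - v)) = iexp (p * u) * iexp (p * - v)" for p u v :: real
    by (simp add: exp_add[symmetric] algebra_simps)
  have c: "integrable lborel (\<lambda>p. ?a p * iexp (p * r))" for r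
    by (rule Bochner_Integration.integrable_bound[OF a]) (auto simp: norm_mult)
  have "(CLBINT t=0..1. (CLBINT s=0..1. (CLBINT p.
        complex_of_real p * iexp (p * (x t - y s)) * complex_of_real (exp (- \<epsilon> * p\<^sup>2 / 2)))))
    = (\<integral>t. indicator {0<..<1} t *\<^sub>R (\<integral>s. indicator {0<..<1} s *\<^sub>R
         (\<integral>p. ?a p * iexp (p * x t) * iexp (p * - y s) \<partial>lborel) \<partial>lborel) \<partial>lborel)"
    unfolding interval_integral_0_1 e gauss_weight_def by (simp add: mult_ac)
  also have "\<dots> = (\<integral>t. indicator {0<..<1} t *\<^sub>R
         (\<integral>p. ?a p * occ_fourier (\<lambda>s. - y s) p * iexp (p * x t) \<partial>lborel) \<partial>lborel)"
    by (subst integral_occ_swap[OF y' c]) (simp add: mult_ac)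
  also have "\<dots> = (\<integral>p. ?a p * occ_fourier (\<lambda>s. - y s) p * occ_fourier x p \<partial>lborel)"
    by (rule integral_occ_swap[OF _ b]) measurable
  finally show ?thesis by (simp add: mult_ac)
qed

lemma occ_fourier_cnj: "cnj (occ_fourier x p) = occ_fourier x (- p)"
  unfolding occ_fourier_def Bochner_Integration.integral_cnj[symmetric] by (simp add: exp_cnj del: Bochner_Integration.integral_cnj)

text \<open>Conjugation reflects \<open>p\<close> in the occupation transforms, while the weight is
  odd; the substitution of \<open>- p\<close> for \<open>p\<close> yields the sign. The integral is
  thus purely imaginary, and \<open>theta_eps\<close> is real.\<close>

lemma cnj_integral_gauss_weight_occ:
  "cnj (\<integral>p. of_real (gauss_weight \<epsilon> p) * occ_fourier x p * occ_fourier y p \<partial>lborel)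
    = - (\<integral>p. of_real (gauss_weight \<epsilon> p) * occ_fourier x p * occ_fourier y p \<partial>lborel)"
proof -
  have "cnj (\<integral>p. of_real (gauss_weight \<epsilon> p) * occ_fourier x p * occ_fourier y p \<partial>lborel)
    = (\<integral>p. - (of_real (gauss_weight \<epsilon> (- p)) * occ_fourier x (- p) * occ_fourier y (- p)) \<partial>lborel)"
    unfolding Bochner_Integration.integral_cnj[symmetric]
    by (simp add: occ_fourier_cnj gauss_weight_def del: Bochner_Integration.integral_cnj)
  also have "\<dots> = - (\<integral>p. of_real (gauss_weight \<epsilon> p) * occ_fourier x p * occ_fourier y p \<partial>lborel)"
    by (subst (2) lborel_integral_real_affine[where c="-1" and t=0]) simp_all
  finally show ?thesis .
qed

text \<open>Independence is assumed for the whole paths over \<open>{0..}\<close>. Composing with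
  functionals of finitely many nonnegative times gives two independent bounded variables, whose
  expectations multiply.\<close>

lemma indep_processes_char:
  assumes "prob_space M" and indep: "indep_processes M X Y"
    and [measurable]: "\<And>t. X t \<in> borel_measurable M" "\<And>t. Y t \<in> borel_measurable M"
    and t: "\<And>k. k < n \<Longrightarrow> 0 \<le> t k" and s: "\<And>k. k < n \<Longrightarrow> 0 \<le> s k"
  shows "(\<integral>\<omega>. iexp (\<Sum>k<n. p k * X (t k) \<omega>) * iexp (- (\<Sum>k<n. p k * Y (s k) \<omega>)) \<partial>M)
      = fdd_char M X n p t * cnj (fdd_char M Y n p s)"
proof -
  interpret prob_space M by fact
  let ?P = "Pi\<^sub>M {0..} (\<lambda>_. borel) :: (real \<Rightarrow> real) measure"
  \<comment> \<open>The parameter \<open>c\<close> takes the values 1 and -1, so that one functional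
    serves both processes.\<close>
  define f where "f t c x = iexp (c * (\<Sum>k<n. p k * x (t k)))" for t :: "nat \<Rightarrow> real" and c :: real and x
  have f: "f t c \<in> borel_measurable ?P" if "\<And>k. k < n \<Longrightarrow> 0 \<le> t k" for t c
  proof -
    have [measurable]: "(\<lambda>x. \<Sum>k<n. p k * x (t k)) \<in> borel_measurable ?P"
      using that by (intro borel_measurable_sum borel_measurable_times measurable_component_singleton) auto
    show ?thesis unfolding f_def by measurable
  qed
  have ind: "indep_var ?P (\<lambda>\<omega>. \<lambda>t\<in>{0..}. X t \<omega>) ?P (\<lambda>\<omega>. \<lambda>t\<in>{0..}. Y t \<omega>)"
    using indep by (simp add: indep_processes_def)
  have "indep_var borel (f t 1 \<circ> (\<lambda>\<omega>. \<lambda>t\<in>{0..}. X t \<omega>)) borel (f s (-1) \<circ> (\<lambda>\<omega>. \<lambda>t\<in>{0..}. Y t \<omega>))"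
    by (rule indep_var_compose[OF ind f f]) (use t s in auto)
  moreover have "f t 1 \<circ> (\<lambda>\<omega>. \<lambda>t\<in>{0..}. X t \<omega>) = (\<lambda>\<omega>. iexp (\<Sum>k<n. p k * X (t k) \<omega>))"
    using t by (auto simp: f_def o_def)
  moreover have "f s (-1) \<circ> (\<lambda>\<omega>. \<lambda>t\<in>{0..}. Y t \<omega>) = (\<lambda>\<omega>. iexp (- (\<Sum>k<n. p k * Y (s k) \<omega>)))"
    using s by (auto simp: f_def o_def)
  ultimately have ind': "indep_var borel (\<lambda>\<omega>. iexp (\<Sum>k<n. p k * X (t k) \<omega>))
      borel (\<lambda>\<omega>. iexp (- (\<Sum>k<n. p k * Y (s k) \<omega>)))" by simp
  have "(\<integral>\<omega>. iexp (\<Sum>k<n. p k * X (t k) \<omega>) * iexp (- (\<Sum>k<n. p k * Y (s k) \<omega>)) \<partial>M)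
    = (\<integral>\<omega>. iexp (\<Sum>k<n. p k * X (t k) \<omega>) \<partial>M) * (\<integral>\<omega>. iexp (- (\<Sum>k<n. p k * Y (s k) \<omega>)) \<partial>M)"
    by (rule indep_var_lebesgue_integral[OF ind']) (auto intro!: integrable_const_bound[where B=1])
  also have "(\<integral>\<omega>. iexp (- (\<Sum>k<n. p k * Y (s k) \<omega>)) \<partial>M) = cnj (fdd_char M Y n p s)"
    unfolding fdd_char_def Bochner_Integration.integral_cnj[symmetric] by (simp add: exp_cnj del: Bochner_Integration.integral_cnj)
  finally show ?thesis by (simp add: fdd_char_def)
qed

section \<open>Moments of the regularized integral\<close>

text \<open>This is \<open>G\<^sub>j\<close> of the introductory sketch. For stable processes the
  characteristic function is nonnegative on the cube, so the modulus changes nothing there.\<close>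

definition occ_energy :: "'a measure \<Rightarrow> (real \<Rightarrow> 'a \<Rightarrow> real) \<Rightarrow> nat \<Rightarrow> (nat \<Rightarrow> real) \<Rightarrow> ennreal" where
  "occ_energy M X n p = (\<integral>\<^sup>+ t. ennreal ((\<Prod>k<n. indicator {0<..<1} (t k)) * cmod (fdd_char M X n p t)) \<partial>lborel_pow n)"

lemma integrable_prod_lborel_pow:
  fixes f :: "real \<Rightarrow> 'c::{real_normed_field,banach,second_countable_topology}"
  assumes "integrable lborel f"
  shows "integrable (lborel_pow n) (\<lambda>x. \<Prod>k<n. f (x k))"
  using lborel_pow.product_integrable_prod[of "{..<n}" "\<lambda>_. f"] assms by simp

lemma integral_prod_lborel_pow:
  fixes f :: "nat \<Rightarrow> real \<Rightarrow> 'c::{real_normed_field,banach,second_countable_topology}"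
  assumes "\<And>k. integrable lborel (f k)"
  shows "(\<integral>x. (\<Prod>k<n. f k (x k)) \<partial>lborel_pow n) = (\<Prod>k<n. integral\<^sup>L lborel (f k))"
  using assms by (intro lborel_pow.product_integral_prod) auto

text \<open>The integrand of the regularized integral, with the time windows built in. A product of
  \<open>n\<close> copies in separate variables is the integrand of the \<open>n\<close>-th
  power.\<close>

definition gauss_kernel :: "real \<Rightarrow> (real \<Rightarrow> real) \<Rightarrow> (real \<Rightarrow> real) \<Rightarrow> real \<Rightarrow> real \<Rightarrow> real \<Rightarrow> complex" where
  "gauss_kernel \<epsilon> x y p t s = of_real (gauss_weight \<epsilon> p) *
     ((indicator {0<..<1} t *\<^sub>R iexp (p * x t)) * (indicator {0<..<1} s *\<^sub>R iexp (p * - y s)))"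

definition gauss_integral :: "real \<Rightarrow> (real \<Rightarrow> real) \<Rightarrow> (real \<Rightarrow> real) \<Rightarrow> complex" where
  "gauss_integral \<epsilon> x y = (\<integral>p. of_real (gauss_weight \<epsilon> p) * occ_fourier x p * occ_fourier (\<lambda>s. - y s) p \<partial>lborel)"

text \<open>The phases have modulus 1, so the product is dominated by Gaussian weights in
  \<open>p\<close> and indicators in \<open>t\<close> and \<open>s\<close>. This holds for each
  fixed positive \<open>\<epsilon>\<close> and justifies every exchange of integrals below;
  uniformity in \<open>\<epsilon>\<close> comes only after the expectation is taken.\<close>

lemma integrable_prod_gauss_kernel:
  fixes X Y :: "real \<Rightarrow> 'a \<Rightarrow> real"
  assumes "prob_space M" and \<epsilon>: "0 < \<epsilon>"
    and X: "(\<lambda>(t, \<omega>). X t \<omega>) \<in> borel_measurable (borel \<Otimes>\<^sub>M M)"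
    and Y: "(\<lambda>(t, \<omega>). Y t \<omega>) \<in> borel_measurable (borel \<Otimes>\<^sub>M M)"
  shows "integrable ((lborel_pow n \<Otimes>\<^sub>M (lborel_pow n \<Otimes>\<^sub>M lborel_pow n)) \<Otimes>\<^sub>M M)
     (\<lambda>((p, t, s), \<omega>). \<Prod>k<n. gauss_kernel \<epsilon> (\<lambda>t. X t \<omega>) (\<lambda>t. Y t \<omega>) (p k) (t k) (s k))"
proof -
  interpret prob_space M by fact
  have [measurable (raw)]: "(\<lambda>z. X (f z) (g z)) \<in> borel_measurable N"
    if "f \<in> borel_measurable N" "g \<in> N \<rightarrow>\<^sub>M M" for f g and N :: "'z measure"
    using measurable_compose[OF measurable_Pair[OF that] X] by simp
  have [measurable (raw)]: "(\<lambda>z. Y (f z) (g z)) \<in> borel_measurable N"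
    if "f \<in> borel_measurable N" "g \<in> N \<rightarrow>\<^sub>M M" for f g and N :: "'z measure"
    using measurable_compose[OF measurable_Pair[OF that] Y] by simp
  let ?I = "\<lambda>t::nat \<Rightarrow> real. \<Prod>k<n. indicator {0<..<1} (t k) :: real"
  let ?a = "\<lambda>p. \<Prod>k<n. \<bar>gauss_weight \<epsilon> (p k)\<bar>"
  have I: "integrable (lborel_pow n) ?I"
    by (rule integrable_prod_lborel_pow) simp
  have a: "integrable (lborel_pow n) ?a"
    using integrable_gauss_weight[OF \<epsilon>] by (intro integrable_prod_lborel_pow integrable_abs)
  have sf2: "sigma_finite_measure (lborel_pow n \<Otimes>\<^sub>M lborel_pow n)"
    by (intro sigma_finite_pair_measure sigma_finite_lborel_pow)
  have I2: "integrable (lborel_pow n \<Otimes>\<^sub>M lborel_pow n) (\<lambda>(t, s). ?I t * ?I s)"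
    by (rule integrable_pair_bound[OF sigma_finite_lborel_pow _ I I]) (auto simp: abs_mult abs_prod intro!: prod_nonneg)
  have I3: "integrable (lborel_pow n \<Otimes>\<^sub>M (lborel_pow n \<Otimes>\<^sub>M lborel_pow n)) (\<lambda>(p, t, s). ?a p * (?I t * ?I s))"
    by (rule integrable_pair_bound[OF sf2 _ a I2]) (auto simp: abs_mult abs_prod intro!: prod_nonneg mult_nonneg_nonneg)
  show ?thesis
    by (rule integrable_pair_bound[OF sigma_finite_measure_axioms _ I3, where v="\<lambda>_. 1"])
       (auto simp: gauss_kernel_def[abs_def] norm_mult prod.distrib prod_norm[symmetric] split_beta'
         intro!: prod_nonneg mult_nonneg_nonneg)
qed

text \<open>The power of an integral is an integral over independent copies of its variables. For
  fixed \<open>p\<close> the time integrals give the occupation transforms, and the remaining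
  momentum integral factorises.\<close>

lemma gauss_integral_power:
  assumes [measurable]: "x \<in> borel_measurable borel" "y \<in> borel_measurable borel" and \<epsilon>: "0 < \<epsilon>"
    and int: "integrable (lborel_pow n \<Otimes>\<^sub>M (lborel_pow n \<Otimes>\<^sub>M lborel_pow n))
     (\<lambda>(p, t, s). \<Prod>k<n. gauss_kernel \<epsilon> x y (p k) (t k) (s k))"
  shows "(gauss_integral \<epsilon> x y) ^ n = (\<integral>(p, t, s). (\<Prod>k<n. gauss_kernel \<epsilon> x y (p k) (t k) (s k))
      \<partial>(lborel_pow n \<Otimes>\<^sub>M (lborel_pow n \<Otimes>\<^sub>M lborel_pow n)))"
proof -
  interpret P: sigma_finite_measure "lborel_pow n" by (rule sigma_finite_lborel_pow)
  interpret PP: pair_sigma_finite "lborel_pow n" "lborel_pow n" ..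
  have "sigma_finite_measure (lborel_pow n \<Otimes>\<^sub>M lborel_pow n)"
    by (intro sigma_finite_pair_measure sigma_finite_lborel_pow)
  then interpret PPP: pair_sigma_finite "lborel_pow n" "lborel_pow n \<Otimes>\<^sub>M lborel_pow n"
    by (intro pair_sigma_finite.intro sigma_finite_lborel_pow)
  let ?a = "\<lambda>p. complex_of_real (gauss_weight \<epsilon> p)"
  let ?e = "\<lambda>x p (t::real). indicator {0<..<1} t *\<^sub>R iexp (p * x t)"
  have ie: "integrable lborel (?e x p)" if "x \<in> borel_measurable borel" for x p
    using integrable_occ[OF that] .
  have y': "(\<lambda>s. - y s) \<in> borel_measurable borel" by measurable
  have pp: "integrable (lborel_pow n) (\<lambda>t. \<Prod>k<n. ?e x (p k) (t k))"
    if "x \<in> borel_measurable borel" for x p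
    using lborel_pow.product_integrable_prod[of "{..<n}" "\<lambda>k. ?e x (p k)"] ie[OF that] by simp
  have split: "(\<Prod>k<n. gauss_kernel \<epsilon> x y (p k) (t k) (s k))
      = (\<Prod>k<n. ?a (p k)) * ((\<Prod>k<n. ?e x (p k) (t k)) * (\<Prod>k<n. ?e (\<lambda>s. - y s) (p k) (s k)))" for p t s
    unfolding gauss_kernel_def prod.distrib by (rule refl)
  have inner: "(\<integral>(t, s). (\<Prod>k<n. gauss_kernel \<epsilon> x y (p k) (t k) (s k)) \<partial>(lborel_pow n \<Otimes>\<^sub>M lborel_pow n))
      = (\<Prod>k<n. ?a (p k) * occ_fourier x (p k) * occ_fourier (\<lambda>s. - y s) (p k))" for p
  proof -
    have "integrable (lborel_pow n \<Otimes>\<^sub>M lborel_pow n)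
        (\<lambda>(t, s). (\<Prod>k<n. ?e x (p k) (t k)) * (\<Prod>k<n. ?e (\<lambda>s. - y s) (p k) (s k)))"
      by (rule integrable_pair_bound[OF sigma_finite_lborel_pow _
            integrable_norm[OF pp[OF assms(1), of p]] integrable_norm[OF pp[OF y', of p]]])
         (auto simp: norm_mult)
    from PP.integral_fst'[OF this]
    have "(\<integral>(t, s). (\<Prod>k<n. ?e x (p k) (t k)) * (\<Prod>k<n. ?e (\<lambda>s. - y s) (p k) (s k)) \<partial>(lborel_pow n \<Otimes>\<^sub>M lborel_pow n))
      = (\<integral>t. (\<Prod>k<n. ?e x (p k) (t k)) \<partial>lborel_pow n) * (\<integral>s. (\<Prod>k<n. ?e (\<lambda>s. - y s) (p k) (s k)) \<partial>lborel_pow n)"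
      by simp
    also have "\<dots> = (\<Prod>k<n. occ_fourier x (p k)) * (\<Prod>k<n. occ_fourier (\<lambda>s. - y s) (p k))"
      unfolding occ_fourier_def
      using integral_prod_lborel_pow[of "\<lambda>k. ?e x (p k)"] integral_prod_lborel_pow[of "\<lambda>k. ?e (\<lambda>s. - y s) (p k)"]
        ie[OF assms(1)] ie[OF y'] by simp
    finally show ?thesis unfolding split
      by (simp add: split_beta' prod.distrib mult_ac)
  qed
  have b: "integrable lborel (\<lambda>p. ?a p * occ_fourier x p * occ_fourier (\<lambda>s. - y s) p)"
    by (rule Bochner_Integration.integrable_bound[OF integrable_gauss_weight[OF \<epsilon>]])
       (use norm_occ_fourier_le in \<open>auto simp: norm_mult y' intro!: mult_left_le mult_le_one
          order_trans[OF mult_left_le[OF norm_occ_fourier_le]]\<close>)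
  have "(\<integral>(p, t, s). (\<Prod>k<n. gauss_kernel \<epsilon> x y (p k) (t k) (s k))
      \<partial>(lborel_pow n \<Otimes>\<^sub>M (lborel_pow n \<Otimes>\<^sub>M lborel_pow n)))
    = (\<integral>p. (\<integral>(t, s). (\<Prod>k<n. gauss_kernel \<epsilon> x y (p k) (t k) (s k)) \<partial>(lborel_pow n \<Otimes>\<^sub>M lborel_pow n)) \<partial>lborel_pow n)"
    using PPP.integral_fst'[OF int] by (simp add: split_beta')
  also have "\<dots> = (\<integral>p. (\<Prod>k<n. ?a (p k) * occ_fourier x (p k) * occ_fourier (\<lambda>s. - y s) (p k)) \<partial>lborel_pow n)"
    by (simp only: inner)
  also have "\<dots> = (gauss_integral \<epsilon> x y) ^ n"
    unfolding gauss_integral_def using integral_prod_lborel_pow[OF b, of n] by simp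
  finally show ?thesis ..
qed

text \<open>The phases combine into one exponential for each process, and independence turns its
  expectation into two characteristic functions. The Gaussian damping is at most 1, so the bound is
  free of \<open>\<epsilon>\<close>.\<close>

lemma norm_expectation_prod_gauss_kernel_le:
  fixes X Y :: "real \<Rightarrow> 'a \<Rightarrow> real"
  assumes M: "prob_space M" and ind: "indep_processes M X Y"
    and [measurable]: "\<And>t. X t \<in> borel_measurable M" "\<And>t. Y t \<in> borel_measurable M" and \<epsilon>: "0 \<le> \<epsilon>"
  shows "norm (\<integral>\<omega>. (\<Prod>k<n. gauss_kernel \<epsilon> (\<lambda>t. X (max 0 t) \<omega>) (\<lambda>t. Y (max 0 t) \<omega>) (p k) (t k) (s k)) \<partial>M)
    \<le> (\<Prod>k<n. \<bar>p k\<bar>) * (((\<Prod>k<n. indicator {0<..<1} (t k)) * norm (fdd_char M X n p t)) *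
        ((\<Prod>k<n. indicator {0<..<1} (s k)) * norm (fdd_char M Y n p s)))"
proof (cases "\<forall>k<n. t k \<in> {0<..<1} \<and> s k \<in> {0<..<1}")
  case False
  then obtain k where "k < n" "t k \<notin> {0<..<1} \<or> s k \<notin> {0<..<1}" by blast
  then have zero: "(\<Prod>k<n. gauss_kernel \<epsilon> (\<lambda>t. X (max 0 t) \<omega>) (\<lambda>t. Y (max 0 t) \<omega>) (p k) (t k) (s k)) = 0" for \<omega>
    by (intro prod_zero bexI[of _ k]) (auto simp: gauss_kernel_def)
  show ?thesis unfolding zero by (auto intro!: mult_nonneg_nonneg prod_nonneg)
next
  case True
  \<comment> \<open>Inside the cube all times are positive, so the truncation at 0 is the
    identity.\<close>
  then have max: "max 0 (t k) = t k" "max 0 (s k) = s k" if "k < n" for k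
    using that by (auto simp: max_def dest: order_less_le_trans)
  have "(\<Prod>k<n. gauss_kernel \<epsilon> (\<lambda>t. X (max 0 t) \<omega>) (\<lambda>t. Y (max 0 t) \<omega>) (p k) (t k) (s k))
    = of_real (\<Prod>k<n. gauss_weight \<epsilon> (p k)) *
        (iexp (\<Sum>k<n. p k * X (t k) \<omega>) * iexp (- (\<Sum>k<n. p k * Y (s k) \<omega>)))" for \<omega>
    using True
    by (simp add: gauss_kernel_def prod.distrib max exp_sum[symmetric] sum_distrib_left sum_negf)
  then have "(\<integral>\<omega>. (\<Prod>k<n. gauss_kernel \<epsilon> (\<lambda>t. X (max 0 t) \<omega>) (\<lambda>t. Y (max 0 t) \<omega>) (p k) (t k) (s k)) \<partial>M)
    = of_real (\<Prod>k<n. gauss_weight \<epsilon> (p k)) * (fdd_char M X n p t * cnj (fdd_char M Y n p s))"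
    using indep_processes_char[OF M ind assms(3,4), of n t s p] True
    by (simp add: less_imp_le del: of_real_prod of_real_sum of_real_minus)
  then have "norm (\<integral>\<omega>. (\<Prod>k<n. gauss_kernel \<epsilon> (\<lambda>t. X (max 0 t) \<omega>) (\<lambda>t. Y (max 0 t) \<omega>) (p k) (t k) (s k)) \<partial>M)
    = (\<Prod>k<n. \<bar>gauss_weight \<epsilon> (p k)\<bar>) * (norm (fdd_char M X n p t) * norm (fdd_char M Y n p s))"
    by (simp add: norm_mult abs_prod del: of_real_prod)
  also have "\<dots> \<le> (\<Prod>k<n. \<bar>p k\<bar>) * (norm (fdd_char M X n p t) * norm (fdd_char M Y n p s))"
    by (intro mult_right_mono prod_mono) (use abs_gauss_weight_le[OF \<epsilon>] in auto)
  finally show ?thesis using True by simp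
qed

section \<open>Measurability and moments of the regularized derivative\<close>

lemma sym_stable_jointly_measurable:
  assumes "sym_stable_process M \<alpha> \<sigma> X"
  shows "(\<lambda>(t, \<omega>). X (max 0 t) \<omega>) \<in> borel_measurable (borel \<Otimes>\<^sub>M M)"
  using assms by (intro cadlag_jointly_measurable) (auto simp: sym_stable_process_def)

lemma theta_eps_eq_gauss_integral:
  assumes X: "sym_stable_process M \<alpha> \<sigma> X" and Y: "sym_stable_process M \<alpha>' \<sigma>' Y"
    and \<omega>: "\<omega> \<in> space M" and \<epsilon>: "0 < \<epsilon>"
  shows "theta_eps X Y \<epsilon> \<omega>
    = \<i> / (2 * complex_of_real pi) * gauss_integral \<epsilon> (\<lambda>t. X (max 0 t) \<omega>) (\<lambda>t. Y (max 0 t) \<omega>)"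
proof -
  have m: "(\<lambda>t. Z (max 0 t) \<omega>) \<in> borel_measurable borel"
    if "sym_stable_process M \<gamma> \<tau> Z" for Z \<gamma> \<tau>
    using measurable_compose[OF measurable_Pair2'[OF \<omega>] sym_stable_jointly_measurable[OF that]] by simp
  \<comment> \<open>The time integrals see only times in \<open>{0<..<1}\<close>, where the
    truncated path agrees with the original one.\<close>
  have pos: "indicator {0<..<1} t *\<^sub>R F (max 0 t) = indicator {0<..<1} t *\<^sub>R F t" for t :: real and F :: "real \<Rightarrow> complex"
    by (auto simp: indicator_def)
  show ?thesis
    unfolding gauss_integral_def regularized_integral_eq[OF m[OF X] m[OF Y] \<epsilon>, symmetric]
    unfolding theta_eps_def interval_integral_0_1
    using pos[of _ "\<lambda>t. \<integral>s. indicator {0<..<1} s *\<^sub>R (CLBINT p.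
        complex_of_real p * iexp (p * (X t \<omega> - Y s \<omega>)) * complex_of_real (exp (- \<epsilon> * p\<^sup>2 / 2))) \<partial>lborel"]
      pos[of _ "\<lambda>s. CLBINT p.
        complex_of_real p * iexp (p * (X _ \<omega> - Y s \<omega>)) * complex_of_real (exp (- \<epsilon> * p\<^sup>2 / 2))"]
    by (simp only:)
qed

lemma borel_measurable_fdd_char:
  assumes "prob_space M" and X: "(\<lambda>(t, \<omega>). X t \<omega>) \<in> borel_measurable (borel \<Otimes>\<^sub>M M)"
  shows "fdd_char M X n p \<in> borel_measurable (lborel_pow n)"
proof -
  interpret prob_space M by fact
  have [measurable (raw)]: "(\<lambda>z. X (f z) (g z)) \<in> borel_measurable N"
    if "f \<in> borel_measurable N" "g \<in> N \<rightarrow>\<^sub>M M" for f g and N :: "'z measure"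
    using measurable_compose[OF measurable_Pair[OF that] X] by simp
  show ?thesis unfolding fdd_char_def[abs_def] by measurable
qed

lemma borel_measurable_occ_energy_integrand:
  assumes X: "sym_stable_process M \<alpha> \<sigma> X"
  shows "(\<lambda>t. ennreal ((\<Prod>k<n. indicator {0<..<1} (t k)) * cmod (fdd_char M X n p t))) \<in> borel_measurable (lborel_pow n)"
proof -
  have M: "prob_space M" using X by (simp add: sym_stable_process_def)
  \<comment> \<open>Joint measurability is known for the truncated process; off the cube both sides
    vanish, and on it truncation has no effect.\<close>
  have eq: "(\<Prod>k<n. indicator {0<..<1} (t k)) * cmod (fdd_char M X n p t)
      = (\<Prod>k<n. indicator {0<..<1} (t k)) * cmod (fdd_char M (\<lambda>t. X (max 0 t)) n p t)" for t :: "nat \<Rightarrow> real"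
  proof (cases "\<forall>k<n. t k \<in> {0<..<1}")
    case True
    then have "fdd_char M X n p t = fdd_char M (\<lambda>t. X (max 0 t)) n p t"
      by (simp add: fdd_char_def max_def order_less_imp_not_less less_imp_le)
    then show ?thesis by simp
  next
    case False
    then obtain k where "k < n" "t k \<notin> {0<..<1}" by blast
    then have zero: "(\<Prod>k<n. indicator {0<..<1} (t k)) = (0::real)"
      by (intro prod_zero bexI[of _ k]) auto
    show ?thesis unfolding zero by simp
  qed
  note [measurable] = borel_measurable_fdd_char[OF M sym_stable_jointly_measurable[OF X]]
  show ?thesis unfolding eq by measurable
qed

lemma theta_eps_real:
  assumes "sym_stable_process M \<alpha> \<sigma> X" and "sym_stable_process M \<alpha>' \<sigma>' Y" and "\<omega> \<in> space M" and "0 < \<epsilon>"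
  shows "theta_eps X Y \<epsilon> \<omega> \<in> \<real>"
  unfolding theta_eps_eq_gauss_integral[OF assms] gauss_integral_def
  by (simp add: Reals_cnj_iff cnj_integral_gauss_weight_occ)

lemma borel_measurable_theta_eps:
  assumes X: "sym_stable_process M \<alpha> \<sigma> X" and Y: "sym_stable_process M \<alpha>' \<sigma>' Y" and \<epsilon>: "0 < \<epsilon>"
  shows "theta_eps X Y \<epsilon> \<in> borel_measurable M"
proof -
  note X' = sym_stable_jointly_measurable[OF X] and Y' = sym_stable_jointly_measurable[OF Y]
  have [measurable (raw)]: "(\<lambda>z. X (max 0 (f z)) (g z)) \<in> borel_measurable N"
    if "f \<in> borel_measurable N" "g \<in> N \<rightarrow>\<^sub>M M" for f g and N :: "'z measure"
    using measurable_compose[OF measurable_Pair[OF that] X'] by simp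
  have [measurable (raw)]: "(\<lambda>z. Y (max 0 (f z)) (g z)) \<in> borel_measurable N"
    if "f \<in> borel_measurable N" "g \<in> N \<rightarrow>\<^sub>M M" for f g and N :: "'z measure"
    using measurable_compose[OF measurable_Pair[OF that] Y'] by simp
  have "(\<lambda>\<omega>. \<i> / (2 * complex_of_real pi) * gauss_integral \<epsilon> (\<lambda>t. X (max 0 t) \<omega>) (\<lambda>t. Y (max 0 t) \<omega>)) \<in> borel_measurable M"
    unfolding gauss_integral_def occ_fourier_def by measurable
  then show ?thesis
    by (subst measurable_cong[OF theta_eps_eq_gauss_integral[OF X Y _ \<epsilon>]])
qed

text \<open>\<open>theta_eps\<close> is real and \<open>n\<close> is even, so the absolute moment is
  the expectation of the plain power. That power expands into a multiple integral, the expectation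
  moves inside, and only then is the modulus taken.\<close>

lemma theta_eps_moment_le:
  assumes X: "sym_stable_process M \<alpha> \<sigma> X" and Y: "sym_stable_process M \<alpha>' \<sigma>' Y"
    and ind: "indep_processes M X Y" and \<epsilon>: "0 < \<epsilon>" and n: "even n"
  shows "(\<integral>\<^sup>+ \<omega>. ennreal (cmod (theta_eps X Y \<epsilon> \<omega>) ^ n) \<partial>M)
    \<le> (\<integral>\<^sup>+ p. ennreal (\<Prod>k<n. \<bar>p k\<bar>) * (occ_energy M X n p * occ_energy M Y n p) \<partial>lborel_pow n)"
proof -
  have M: "prob_space M" using X by (simp add: sym_stable_process_def)
  then interpret prob_space M .
  have Xm: "X t \<in> borel_measurable M" and Ym: "Y t \<in> borel_measurable M" for t
    using X Y by (auto simp: sym_stable_process_def)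
  let ?P = "lborel_pow n"
  interpret P: sigma_finite_measure ?P by (rule sigma_finite_lborel_pow)
  have sf2: "sigma_finite_measure (?P \<Otimes>\<^sub>M ?P)"
    by (intro sigma_finite_pair_measure sigma_finite_lborel_pow)
  interpret P2: sigma_finite_measure "?P \<Otimes>\<^sub>M ?P" by (rule sf2)
  have sf3: "sigma_finite_measure (?P \<Otimes>\<^sub>M (?P \<Otimes>\<^sub>M ?P))"
    by (intro sigma_finite_pair_measure sigma_finite_lborel_pow sf2)
  interpret MP: pair_sigma_finite "?P \<Otimes>\<^sub>M (?P \<Otimes>\<^sub>M ?P)" M
    by (intro pair_sigma_finite.intro sf3 sigma_finite_measure_axioms)
  define F where "F = (\<lambda>((p, t, s), \<omega>). \<Prod>k<n. gauss_kernel \<epsilon> (\<lambda>t. X (max 0 t) \<omega>) (\<lambda>t. Y (max 0 t) \<omega>) (p k) (t k) (s k))"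
  have F: "integrable ((?P \<Otimes>\<^sub>M (?P \<Otimes>\<^sub>M ?P)) \<Otimes>\<^sub>M M) F"
    unfolding F_def
    by (rule integrable_prod_gauss_kernel[OF M \<epsilon> sym_stable_jointly_measurable[OF X] sym_stable_jointly_measurable[OF Y]])
  define G where "G \<omega> = gauss_integral \<epsilon> (\<lambda>t. X (max 0 t) \<omega>) (\<lambda>t. Y (max 0 t) \<omega>)" for \<omega>
  have path: "(\<lambda>t. Z (max 0 t) \<omega>) \<in> borel_measurable borel"
    if "sym_stable_process M \<gamma> \<tau> Z" "\<omega> \<in> space M" for Z \<gamma> \<tau> \<omega>
    using measurable_compose[OF measurable_Pair2'[OF that(2)] sym_stable_jointly_measurable[OF that(1)]] by simp
  have AE_int: "AE \<omega> in M. integrable (?P \<Otimes>\<^sub>M (?P \<Otimes>\<^sub>M ?P)) (\<lambda>q. F (q, \<omega>))"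
    using MP.AE_integrable_snd[of "\<lambda>q \<omega>. F (q, \<omega>)"] F by simp
  have G_pow: "AE \<omega> in M. G \<omega> ^ n = (\<integral>q. F (q, \<omega>) \<partial>(?P \<Otimes>\<^sub>M (?P \<Otimes>\<^sub>M ?P)))"
    using AE_int AE_space
  proof eventually_elim
    case (elim \<omega>)
    then show ?case
      unfolding G_def F_def
      using gauss_integral_power[OF path[OF X] path[OF Y] \<epsilon>, of \<omega> \<omega> n] by (simp add: split_beta')
  qed
  \<comment> \<open>The scalar prefactor of \<open>theta_eps\<close> raised to the power
    \<open>n\<close>; its modulus is at most 1 and is simply discarded.\<close>
  define c where "c = (\<i> / (2 * complex_of_real pi)) ^ n"
  have c: "cmod c \<le> 1"
    using pi_gt3 by (auto simp: c_def norm_power norm_divide norm_mult intro!: power_le_one)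
  have pow: "of_real (cmod (theta_eps X Y \<epsilon> \<omega>) ^ n) = c * G \<omega> ^ n" if w: "\<omega> \<in> space M" for \<omega>
  proof -
    obtain r where r: "theta_eps X Y \<epsilon> \<omega> = of_real r"
      using theta_eps_real[OF X Y w \<epsilon>] by (auto elim: Reals_cases)
    have "of_real (cmod (theta_eps X Y \<epsilon> \<omega>) ^ n) = (theta_eps X Y \<epsilon> \<omega>) ^ n"
      using n by (simp add: r power_even_abs)
    also have "\<dots> = c * G \<omega> ^ n"
      unfolding theta_eps_eq_gauss_integral[OF X Y w \<epsilon>] c_def G_def by (rule power_mult_distrib)
    finally show ?thesis .
  qed
  have intF: "integrable M (\<lambda>\<omega>. \<integral>q. F (q, \<omega>) \<partial>(?P \<Otimes>\<^sub>M (?P \<Otimes>\<^sub>M ?P)))"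
    using MP.integrable_snd[of "\<lambda>q \<omega>. F (q, \<omega>)"] F by simp
  note [measurable] = borel_measurable_theta_eps[OF X Y \<epsilon>]
  have eq: "AE \<omega> in M. c * (\<integral>q. F (q, \<omega>) \<partial>(?P \<Otimes>\<^sub>M (?P \<Otimes>\<^sub>M ?P))) = of_real (cmod (theta_eps X Y \<epsilon> \<omega>) ^ n)"
    using G_pow AE_space by eventually_elim (simp add: pow del: of_real_power)
  have int': "integrable M (\<lambda>\<omega>. complex_of_real (cmod (theta_eps X Y \<epsilon> \<omega>) ^ n))"
    by (rule integrable_cong_AE_imp[OF integrable_mult_right[OF intF] _ eq]) measurable
  then have int: "integrable M (\<lambda>\<omega>. cmod (theta_eps X Y \<epsilon> \<omega>) ^ n)"
    unfolding complex_of_real_integrable_eq .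
  have "(\<integral>\<^sup>+ \<omega>. ennreal (cmod (theta_eps X Y \<epsilon> \<omega>) ^ n) \<partial>M) = ennreal (\<integral>\<omega>. cmod (theta_eps X Y \<epsilon> \<omega>) ^ n \<partial>M)"
    by (rule nn_integral_eq_integral[OF int]) simp
  also have "(\<integral>\<omega>. cmod (theta_eps X Y \<epsilon> \<omega>) ^ n \<partial>M) = cmod (\<integral>\<omega>. complex_of_real (cmod (theta_eps X Y \<epsilon> \<omega>) ^ n) \<partial>M)"
    unfolding integral_complex_of_real by (simp add: integral_nonneg_AE)
  also have "(\<integral>\<omega>. complex_of_real (cmod (theta_eps X Y \<epsilon> \<omega>) ^ n) \<partial>M)
      = (\<integral>\<omega>. c * (\<integral>q. F (q, \<omega>) \<partial>(?P \<Otimes>\<^sub>M (?P \<Otimes>\<^sub>M ?P))) \<partial>M)"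
    by (rule integral_cong_AE[symmetric, OF _ _ eq]) (use intF in measurable)
  also have "\<dots> = c * (\<integral>\<omega>. (\<integral>q. F (q, \<omega>) \<partial>(?P \<Otimes>\<^sub>M (?P \<Otimes>\<^sub>M ?P))) \<partial>M)"
    by (rule integral_mult_right_zero)
  also have "ennreal (cmod \<dots>) \<le> ennreal (cmod (\<integral>\<omega>. (\<integral>q. F (q, \<omega>) \<partial>(?P \<Otimes>\<^sub>M (?P \<Otimes>\<^sub>M ?P))) \<partial>M))"
    using c by (intro ennreal_leI) (simp add: norm_mult mult_left_le_one_le)
  \<comment> \<open>From here on the modulus stands outside the expectation but inside the integral
    over momenta and times.\<close>
  also have "\<dots> \<le> (\<integral>\<^sup>+ q. ennreal (cmod (\<integral>\<omega>. F (q, \<omega>) \<partial>M)) \<partial>(?P \<Otimes>\<^sub>M (?P \<Otimes>\<^sub>M ?P)))"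
    by (rule norm_integral_swap_le[OF sf3 sigma_finite_measure_axioms F])
  also have "\<dots> = (\<integral>\<^sup>+ p. (\<integral>\<^sup>+ t. (\<integral>\<^sup>+ s. ennreal (cmod (\<integral>\<omega>. F ((p, t, s), \<omega>) \<partial>M)) \<partial>?P) \<partial>?P) \<partial>?P)"
  proof -
    define H where "H q = ennreal (cmod (\<integral>\<omega>. F (q, \<omega>) \<partial>M))" for q
    have m[measurable]: "H \<in> borel_measurable (?P \<Otimes>\<^sub>M (?P \<Otimes>\<^sub>M ?P))"
      unfolding H_def[abs_def] using borel_measurable_integrable[OF MP.integrable_fst'[OF F]] by measurable
    have "integral\<^sup>N (?P \<Otimes>\<^sub>M (?P \<Otimes>\<^sub>M ?P)) H = (\<integral>\<^sup>+ p. (\<integral>\<^sup>+ z. H (p, z) \<partial>(?P \<Otimes>\<^sub>M ?P)) \<partial>?P)"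
      by (rule P2.nn_integral_fst[OF m, symmetric])
    also have "\<dots> = (\<integral>\<^sup>+ p. (\<integral>\<^sup>+ t. (\<integral>\<^sup>+ s. H (p, t, s) \<partial>?P) \<partial>?P) \<partial>?P)"
      by (intro nn_integral_cong P.nn_integral_fst[symmetric]) measurable
    finally show ?thesis unfolding H_def .
  qed
  also have "\<dots> \<le> (\<integral>\<^sup>+ p. (\<integral>\<^sup>+ t. (\<integral>\<^sup>+ s. ennreal (\<Prod>k<n. \<bar>p k\<bar>) *
       (ennreal ((\<Prod>k<n. indicator {0<..<1} (t k)) * cmod (fdd_char M X n p t)) *
        ennreal ((\<Prod>k<n. indicator {0<..<1} (s k)) * cmod (fdd_char M Y n p s))) \<partial>?P) \<partial>?P) \<partial>?P)"
  proof (intro nn_integral_mono)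
    fix p t s :: "nat \<Rightarrow> real"
    let ?a = "(\<Prod>k<n. indicator {0<..<1} (t k)) * cmod (fdd_char M X n p t)"
    let ?b = "(\<Prod>k<n. indicator {0<..<1} (s k)) * cmod (fdd_char M Y n p s)"
    have "cmod (\<integral>\<omega>. F ((p, t, s), \<omega>) \<partial>M) \<le> (\<Prod>k<n. \<bar>p k\<bar>) * (?a * ?b)"
      unfolding F_def using norm_expectation_prod_gauss_kernel_le[OF M ind Xm Ym, where p=p and t=t and s=s and n=n and \<epsilon>=\<epsilon>] \<epsilon> by simp
    then have "ennreal (cmod (\<integral>\<omega>. F ((p, t, s), \<omega>) \<partial>M)) \<le> ennreal ((\<Prod>k<n. \<bar>p k\<bar>) * (?a * ?b))"
      by (rule ennreal_leI)
    also have "\<dots> = ennreal (\<Prod>k<n. \<bar>p k\<bar>) * (ennreal ?a * ennreal ?b)"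
      by (subst ennreal_mult', simp add: prod_nonneg, subst ennreal_mult')
         (auto intro!: mult_nonneg_nonneg prod_nonneg)
    finally show "ennreal (cmod (\<integral>\<omega>. F ((p, t, s), \<omega>) \<partial>M)) \<le> ennreal (\<Prod>k<n. \<bar>p k\<bar>) * (ennreal ?a * ennreal ?b)" .
  qed
  also have "\<dots> = (\<integral>\<^sup>+ p. ennreal (\<Prod>k<n. \<bar>p k\<bar>) * (occ_energy M X n p * occ_energy M Y n p) \<partial>?P)"
    using borel_measurable_occ_energy_integrand[OF X] borel_measurable_occ_energy_integrand[OF Y]
    by (simp add: nn_integral_cmult nn_integral_multc occ_energy_def)
  finally show ?thesis .
qed

text \<open>With \<open>\<kappa> = n\<close>, the growth \<open>(fact n)^2 \<le> n^(2 * n)\<close>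
  is cancelled by the \<open>-2\<close> in the exponent \<open>2 / \<alpha> - 2\<close>. What
  remains is \<open>n powr (2 / \<alpha>)\<close> to the power \<open>n\<close>, up to factors
  exponential in \<open>n\<close>.\<close>

lemma theta_eps_moment_bound:
  assumes \<alpha>: "3/2 < \<alpha>" and X: "sym_stable_process M \<alpha> \<sigma>1 X" and Y: "sym_stable_process M \<alpha> \<sigma>2 Y"
    and ind: "indep_processes M X Y"
  obtains C where "0 < C" "\<And>n \<epsilon>. \<lbrakk>even n; 0 < n; 0 < \<epsilon>\<rbrakk> \<Longrightarrow>
    (\<integral>\<^sup>+ \<omega>. ennreal (cmod (theta_eps X Y \<epsilon> \<omega>) ^ n) \<partial>M) \<le> ennreal ((C * real n powr (2 / \<alpha>)) ^ n)"
proof -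
  have \<sigma>: "0 < \<sigma>1 powr \<alpha>" "0 < \<sigma>2 powr \<alpha>" using X Y by (auto simp: sym_stable_process_def)
  define J where "J c = (\<integral>\<^sup>+ w. ennreal ((1 + \<bar>w\<bar>)\<^sup>2 / (1 + c * \<bar>w\<bar> powr \<alpha>)\<^sup>2) \<partial>lborel)" for c
  have J_finite: "\<exists>j\<ge>0. J c = ennreal j" if "0 < c" for c
    using resolvent_integral_finite[OF \<alpha> that] unfolding J_def[symmetric] by (cases "J c") auto
  obtain j1 where j1: "0 \<le> j1" "J (\<sigma>1 powr \<alpha>) = ennreal j1" using J_finite[OF \<sigma>(1)] by blast
  obtain j2 where j2: "0 \<le> j2" "J (\<sigma>2 powr \<alpha>) = ennreal j2" using J_finite[OF \<sigma>(2)] by blast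
  \<comment> \<open>The square of \<open>exp 1\<close> comes from \<open>(exp \<kappa>)^2\<close> at
    \<open>\<kappa> = n\<close>; the sum bounds the \<open>n\<close>-th root of
    \<open>j1 ^ n + j2 ^ n\<close>, and its summand 1 keeps \<open>C\<close> positive.\<close>
  define C where "C = (exp 1)\<^sup>2 * (j1 + j2 + 1)"
  show ?thesis
  proof (rule that)
    show "0 < C" using j1 j2 by (simp add: C_def add_nonneg_pos)
  next
    fix n :: nat and \<epsilon> :: real assume n: "even n" "0 < n" and \<epsilon>: "0 < \<epsilon>"
    define R where "R c p = ennreal (\<Sum>\<pi> | \<pi> permutes {..<n}. resolvent_prod \<alpha> c (real n) n (p \<circ> \<pi>))" for c p
    have Rm[measurable]: "R c \<in> borel_measurable (lborel_pow n)" for c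
    proof -
      have "(\<lambda>p. resolvent_prod \<alpha> c (real n) n (\<lambda>i. p (\<pi> i))) \<in> borel_measurable (lborel_pow n)"
        if "\<pi> permutes {..<n}" for \<pi>
        by (rule borel_measurable_permute_coords[OF that])
           (auto simp: resolvent_prod_def intro!: prod.cong arg_cong2[where f="(*)"] arg_cong2[where f="(/)"]
             arg_cong2[where f="(+)"] arg_cong2[where f="(powr)"] arg_cong[where f=abs] sum.cong)
      then show ?thesis unfolding R_def o_def by measurable
    qed
    let ?a = "\<lambda>p. ennreal (\<Prod>k<n. \<bar>p k\<bar>)"
    define B where "B = (fact n)\<^sup>2 * (exp (real n))\<^sup>2 * (real n powr (2 / \<alpha> - 2)) ^ n"
    have B: "0 \<le> B" by (simp add: B_def)
    have bound: "(\<integral>\<^sup>+ p. ?a p * (R c p)\<^sup>2 \<partial>lborel_pow n) \<le> ennreal (B * j ^ n)"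
      if "0 < c" "J c = ennreal j" "0 \<le> j" for c j
    proof -
      have "(\<integral>\<^sup>+ p. ?a p * (R c p)\<^sup>2 \<partial>lborel_pow n)
          \<le> ennreal ((fact n)\<^sup>2 * (exp (real n))\<^sup>2) * (ennreal (real n powr (2 / \<alpha> - 2)) * J c) ^ n"
        unfolding R_def J_def by (rule nn_integral_resolvent_sum_square_le) (use \<alpha> n that in auto)
      also have "\<dots> = ennreal (B * j ^ n)"
        using that by (simp add: B_def ennreal_mult'[symmetric] ennreal_power power_mult_distrib mult_ac)
      finally show ?thesis .
    qed
    have "(\<integral>\<^sup>+ \<omega>. ennreal (cmod (theta_eps X Y \<epsilon> \<omega>) ^ n) \<partial>M)
      \<le> (\<integral>\<^sup>+ p. ?a p * (occ_energy M X n p * occ_energy M Y n p) \<partial>lborel_pow n)"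
      by (rule theta_eps_moment_le[OF X Y ind \<epsilon> n(1)])
    also have "\<dots> \<le> (\<integral>\<^sup>+ p. ?a p * (R (\<sigma>1 powr \<alpha>) p)\<^sup>2 + ?a p * (R (\<sigma>2 powr \<alpha>) p)\<^sup>2 \<partial>lborel_pow n)"
    proof (rule nn_integral_mono)
      fix p :: "nat \<Rightarrow> real"
      let ?r = "R (\<sigma>1 powr \<alpha>) p" and ?s = "R (\<sigma>2 powr \<alpha>) p"
      have "occ_energy M X n p \<le> ?r" "occ_energy M Y n p \<le> ?s"
        unfolding occ_energy_def R_def
        using n by (intro nn_integral_fdd_char_le X Y; simp)+
      then have "occ_energy M X n p * occ_energy M Y n p \<le> ?r * ?s"
        by (rule mult_mono) simp_all
      \<comment> \<open>Passing through the maximum separates the two processes without any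
        subtraction in \<open>ennreal\<close>.\<close>
      also have "\<dots> \<le> max ?r ?s * max ?r ?s" by (intro mult_mono) auto
      also have "\<dots> \<le> ?r\<^sup>2 + ?s\<^sup>2" by (auto simp: max_def power2_eq_square)
      finally show "?a p * (occ_energy M X n p * occ_energy M Y n p) \<le> ?a p * ?r\<^sup>2 + ?a p * ?s\<^sup>2"
        by (simp add: distrib_left[symmetric] mult_left_mono)
    qed
    also have "\<dots> = (\<integral>\<^sup>+ p. ?a p * (R (\<sigma>1 powr \<alpha>) p)\<^sup>2 \<partial>lborel_pow n) + (\<integral>\<^sup>+ p. ?a p * (R (\<sigma>2 powr \<alpha>) p)\<^sup>2 \<partial>lborel_pow n)"
      by (rule nn_integral_add) measurable
    also have "\<dots> \<le> ennreal (B * j1 ^ n) + ennreal (B * j2 ^ n)"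
      by (intro add_mono bound \<sigma> j1 j2)
    also have "\<dots> = ennreal (B * (j1 ^ n + j2 ^ n))"
      using B j1 j2 by (simp add: distrib_left)
    also have "\<dots> \<le> ennreal ((C * real n powr (2 / \<alpha>)) ^ n)"
    proof (rule ennreal_leI)
      have "j1 ^ n + j2 ^ n \<le> (j1 + j2 + 1) ^ n"
      proof -
        obtain m where m: "n = Suc m" using n(2) by (cases n) auto
        have "j1 ^ n + j2 ^ n \<le> j1 * (j1 + j2 + 1) ^ m + j2 * (j1 + j2 + 1) ^ m"
          unfolding m power_Suc using j1 j2 by (intro add_mono mult_left_mono power_mono) auto
        also have "\<dots> \<le> (j1 + j2 + 1) * (j1 + j2 + 1) ^ m"
          unfolding distrib_right[symmetric] using j1 j2 by (intro mult_right_mono) auto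
        finally show ?thesis by (simp add: m)
      qed
      moreover have "B \<le> ((exp 1)\<^sup>2 * real n powr (2 / \<alpha>)) ^ n"
      proof -
        have "(fact n :: real) \<le> real n ^ n" using fact_le_power[of n, where 'a=real] by simp
        then have "B \<le> (real n ^ n)\<^sup>2 * (exp (real n))\<^sup>2 * (real n powr (2 / \<alpha> - 2)) ^ n"
          unfolding B_def by (intro mult_right_mono power_mono) auto
        also have "\<dots> = ((exp 1)\<^sup>2 * (real n ^ 2 * real n powr (2 / \<alpha> - 2))) ^ n"
          by (simp add: power_mult_distrib power_mult[symmetric] mult.commute exp_of_nat_mult[symmetric] flip: exp_of_nat2_mult)
        also have "real n ^ 2 * real n powr (2 / \<alpha> - 2) = real n powr (2 / \<alpha>)"
          using n by (simp add: powr_diff)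
        finally show ?thesis .
      qed
      ultimately have "B * (j1 ^ n + j2 ^ n) \<le> ((exp 1)\<^sup>2 * real n powr (2 / \<alpha>)) ^ n * (j1 + j2 + 1) ^ n"
        using B j1 j2 by (intro mult_mono) auto
      also have "\<dots> = (C * real n powr (2 / \<alpha>)) ^ n"
        by (simp add: C_def power_mult_distrib mult_ac)
      finally show "B * (j1 ^ n + j2 ^ n) \<le> (C * real n powr (2 / \<alpha>)) ^ n" .
    qed
    finally show "(\<integral>\<^sup>+ \<omega>. ennreal (cmod (theta_eps X Y \<epsilon> \<omega>) ^ n) \<partial>M) \<le> ennreal ((C * real n powr (2 / \<alpha>)) ^ n)" .
  qed
qed

section \<open>From moments to exponential integrability\<close>

text \<open>A Fatou argument for convergence in probability. Truncation at \<open>K\<close> makes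
  the event where \<open>Z \<epsilon>\<close> is far from \<open>\<theta>\<close> contribute at most
  \<open>K ^ n\<close> times its probability, which tends to 0. Monotone convergence in
  \<open>K\<close> then removes the truncation.\<close>

lemma (in prob_space) moment_le_of_conv_in_prob:
  assumes conv: "conv_in_prob_at0 M Z \<theta>" and [measurable]: "\<theta> \<in> borel_measurable M"
    and Z: "\<And>\<epsilon>. 0 < \<epsilon> \<Longrightarrow> Z \<epsilon> \<in> borel_measurable M"
    and bound: "\<And>\<epsilon>. 0 < \<epsilon> \<Longrightarrow> (\<integral>\<^sup>+ \<omega>. ennreal (cmod (Z \<epsilon> \<omega>) ^ n) \<partial>M) \<le> ennreal B"
    and B: "0 \<le> B"
  shows "(\<integral>\<^sup>+ \<omega>. ennreal (cmod (\<theta> \<omega>) ^ n) \<partial>M) \<le> ennreal (2 ^ n * (B + 1))"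
proof -
  have trunc: "(\<integral>\<^sup>+ \<omega>. ennreal (min (cmod (\<theta> \<omega>)) (real K) ^ n) \<partial>M) \<le> ennreal (2 ^ n * (B + 1))" for K :: nat
  proof (rule ennreal_le_epsilon)
    fix e :: real assume e: "0 < e"
    \<comment> \<open>Distance 1 suffices: off the bad event \<open>cmod (\<theta> \<omega>)\<close>
      is at most \<open>cmod (Z \<epsilon> \<omega>) + 1\<close>, which costs the factor
      \<open>2 ^ n\<close> and the summand 1 in the bound.\<close>
    define bad where "bad \<epsilon> = {\<omega> \<in> space M. 1 < cmod (Z \<epsilon> \<omega> - \<theta> \<omega>)}" for \<epsilon>
    have "((\<lambda>\<epsilon>. real K ^ n * measure M (bad \<epsilon>)) \<longlongrightarrow> real K ^ n * 0) (at_right 0)"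
      unfolding bad_def using conv by (intro tendsto_mult_left) (simp add: conv_in_prob_at0_def)
    then have "\<forall>\<^sub>F \<epsilon> in at_right 0. real K ^ n * measure M (bad \<epsilon>) < e"
      by (rule order_tendstoD(2)) (use e in simp)
    moreover have "\<forall>\<^sub>F \<epsilon> in at_right (0::real). 0 < \<epsilon>"
      by (rule eventually_at_right_less)
    ultimately have "\<forall>\<^sub>F \<epsilon> in at_right 0. 0 < \<epsilon> \<and> real K ^ n * measure M (bad \<epsilon>) < e"
      by eventually_elim simp
    from eventually_happens'[OF _ this] obtain \<epsilon> where \<epsilon>: "0 < \<epsilon>" and small: "real K ^ n * measure M (bad \<epsilon>) < e"
      by auto
    note [measurable] = Z[OF \<epsilon>]
    have bad[measurable]: "bad \<epsilon> \<in> sets M" unfolding bad_def by measurable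
    have pt: "min (cmod (\<theta> \<omega>)) (real K) ^ n \<le> 2 ^ n * cmod (Z \<epsilon> \<omega>) ^ n + 2 ^ n + real K ^ n * indicator (bad \<epsilon>) \<omega>"
      if "\<omega> \<in> space M" for \<omega>
    proof (cases "\<omega> \<in> bad \<epsilon>")
      case True
      have "min (cmod (\<theta> \<omega>)) (real K) ^ n \<le> real K ^ n" by (intro power_mono) auto
      then show ?thesis using True by (simp add: add_increasing)
    next
      case False
      then have "cmod (Z \<epsilon> \<omega> - \<theta> \<omega>) \<le> 1" using that by (simp add: bad_def)
      then have "cmod (\<theta> \<omega>) \<le> cmod (Z \<epsilon> \<omega>) + 1"
        using norm_triangle_sub[of "\<theta> \<omega>" "Z \<epsilon> \<omega>"] by (simp add: norm_minus_commute)
      then have "min (cmod (\<theta> \<omega>)) (real K) ^ n \<le> (2 * max (cmod (Z \<epsilon> \<omega>)) 1) ^ n"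
        by (intro power_mono) auto
      also have "\<dots> \<le> 2 ^ n * (cmod (Z \<epsilon> \<omega>) ^ n + 1)"
        by (auto simp: max_def power_mult_distrib)
      finally show ?thesis using False by (simp add: algebra_simps)
    qed
    have "(\<integral>\<^sup>+ \<omega>. ennreal (min (cmod (\<theta> \<omega>)) (real K) ^ n) \<partial>M)
      \<le> (\<integral>\<^sup>+ \<omega>. ennreal (2 ^ n) * ennreal (cmod (Z \<epsilon> \<omega>) ^ n) + ennreal (2 ^ n) + ennreal (real K ^ n) * indicator (bad \<epsilon>) \<omega> \<partial>M)"
    proof (rule nn_integral_mono)
      fix \<omega> assume \<omega>: "\<omega> \<in> space M"
      have "ennreal (min (cmod (\<theta> \<omega>)) (real K) ^ n)
          \<le> ennreal (2 ^ n * cmod (Z \<epsilon> \<omega>) ^ n + 2 ^ n + real K ^ n * indicator (bad \<epsilon>) \<omega>)"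
        by (rule ennreal_leI[OF pt[OF \<omega>]])
      also have "\<dots> = ennreal (2 ^ n) * ennreal (cmod (Z \<epsilon> \<omega>) ^ n) + ennreal (2 ^ n) + ennreal (real K ^ n) * indicator (bad \<epsilon>) \<omega>"
        by (cases "\<omega> \<in> bad \<epsilon>") (simp_all add: ennreal_mult' ennreal_plus del: ennreal_power)
      finally show "ennreal (min (cmod (\<theta> \<omega>)) (real K) ^ n)
        \<le> ennreal (2 ^ n) * ennreal (cmod (Z \<epsilon> \<omega>) ^ n) + ennreal (2 ^ n) + ennreal (real K ^ n) * indicator (bad \<epsilon>) \<omega>" .
    qed
    also have "\<dots> = ennreal (2 ^ n) * (\<integral>\<^sup>+ \<omega>. ennreal (cmod (Z \<epsilon> \<omega>) ^ n) \<partial>M) + ennreal (2 ^ n)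
        + ennreal (real K ^ n) * emeasure M (bad \<epsilon>)"
      by (subst nn_integral_add, measurable, subst nn_integral_add, measurable)
         (simp add: nn_integral_cmult emeasure_space_1)
    also have "\<dots> \<le> ennreal (2 ^ n) * ennreal B + ennreal (2 ^ n) + ennreal (real K ^ n) * ennreal (measure M (bad \<epsilon>))"
      unfolding emeasure_eq_measure by (intro add_mono mult_left_mono bound \<epsilon> order_refl) simp_all
    also have "\<dots> = ennreal (2 ^ n * (B + 1)) + ennreal (real K ^ n * measure M (bad \<epsilon>))"
      using B by (simp add: ennreal_mult'[symmetric] ennreal_plus[symmetric] distrib_left del: ennreal_plus)
    also have "\<dots> \<le> ennreal (2 ^ n * (B + 1)) + ennreal e"
      using small by (intro add_left_mono ennreal_leI) simp
    finally show "(\<integral>\<^sup>+ \<omega>. ennreal (min (cmod (\<theta> \<omega>)) (real K) ^ n) \<partial>M) \<le> ennreal (2 ^ n * (B + 1)) + ennreal e" .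
  qed
  let ?f = "\<lambda>K \<omega>. ennreal (min (cmod (\<theta> \<omega>)) (real K) ^ n)"
  have "(\<integral>\<^sup>+ \<omega>. ennreal (cmod (\<theta> \<omega>) ^ n) \<partial>M) \<le> (\<integral>\<^sup>+ \<omega>. (SUP K. ?f K \<omega>) \<partial>M)"
  proof (rule nn_integral_mono)
    fix \<omega>
    obtain K :: nat where "cmod (\<theta> \<omega>) \<le> real K" using real_arch_simple by blast
    then show "ennreal (cmod (\<theta> \<omega>) ^ n) \<le> (SUP K. ?f K \<omega>)"
      by (intro SUP_upper2[of K]) (simp_all add: min_def)
  qed
  also have "\<dots> = (SUP K. \<integral>\<^sup>+ \<omega>. ?f K \<omega> \<partial>M)"
    by (rule nn_integral_monotone_convergence_SUP)
       (auto simp: incseq_def le_fun_def intro!: ennreal_leI power_mono)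
  also have "\<dots> \<le> ennreal (2 ^ n * (B + 1))" by (rule SUP_least) (rule trunc)
  finally show ?thesis .
qed

text \<open>For each value \<open>y\<close> a single normalised even power, of order about
  \<open>(y / L) powr (1 / q)\<close>, already dominates the exponential up to a constant. Summing
  over all even orders removes the dependence on \<open>y\<close>, and the expectations form a
  convergent geometric series.\<close>

lemma (in prob_space) exp_integrable_of_moments:
  fixes Y :: "'a \<Rightarrow> real" and C q \<beta> :: real
  assumes [measurable]: "Y \<in> borel_measurable M" and Y: "\<And>\<omega>. 0 \<le> Y \<omega>"
    and C: "0 < C" and q: "0 < q" and \<beta>: "0 \<le> \<beta>" "\<beta> \<le> 1 / q"
    and moments: "\<And>n. even n \<Longrightarrow> 0 < n \<Longrightarrow> (\<integral>\<^sup>+ \<omega>. ennreal (Y \<omega> ^ n) \<partial>M) \<le> ennreal ((C * real n powr q) ^ n)"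
  shows "\<exists>c>0. (\<integral>\<^sup>+ \<omega>. ennreal (exp (c * Y \<omega> powr \<beta>)) \<partial>M) < \<infinity>"
proof -
  \<comment> \<open>The 2 in \<open>D\<close> makes the expectation of \<open>T m\<close> at most
    \<open>(1 / 2) ^ N m\<close>. The factor \<open>exp 1\<close> in \<open>L\<close> makes
    \<open>T m y\<close> at least \<open>exp 1 ^ N m\<close> once
    \<open>real (N m) powr q \<le> y / L\<close>. The choice of \<open>c\<close> turns
    \<open>c * y powr (1 / q)\<close> into \<open>(y / L) powr (1 / q)\<close>.\<close>
  define D where "D = 2 * C"
  define L where "L = exp 1 * D"
  define c where "c = L powr (- 1 / q)"
  define N where "N m = 2 * Suc m" for m
  have N: "0 < N m" "even (N m)" for m by (simp_all add: N_def)
  define T where "T m y = (y / (D * real (N m) powr q)) ^ N m" for m y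
  have D: "0 < D" and L: "0 < L" and c: "0 < c" using C by (simp_all add: D_def L_def c_def)
  have pt: "ennreal (exp (c * y powr \<beta>)) \<le> ennreal (exp (c + 2)) * (1 + (\<Sum>m. ennreal (T m y)))"
    if y: "0 \<le> y" for y
  proof -
    define x where "x = (y / L) powr (1 / q)"
    have x_eq: "c * y powr (1 / q) = x"
      using y L by (simp add: x_def c_def powr_divide powr_minus_divide)
    have "y powr \<beta> \<le> 1 + y powr (1 / q)"
    proof (cases "1 \<le> y")
      case True
      then have "y powr \<beta> \<le> y powr (1 / q)" using \<beta> by (intro powr_mono) auto
      then show ?thesis by simp
    next
      case False
      then have "y powr \<beta> \<le> 1" using y \<beta> by (intro powr_le1) auto
      then show ?thesis by (simp add: add_increasing2)
    qed
    then have "c * y powr \<beta> \<le> c + x"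
      using mult_left_mono[of "y powr \<beta>" "1 + y powr (1 / q)" c] c by (simp add: distrib_left x_eq)
    then have 1: "exp (c * y powr \<beta>) \<le> exp (c + 2) * exp (x - 2)"
      by (simp add: exp_add[symmetric])
    have 2: "ennreal (exp (x - 2)) \<le> 1 + (\<Sum>m. ennreal (T m y))"
    proof (cases "x < 2")
      case True
      then have "ennreal (exp (x - 2)) \<le> ennreal 1" by (intro ennreal_leI) simp
      then show ?thesis by (simp add: add_increasing2)
    next
      case False
      \<comment> \<open>\<open>N m\<close> becomes the largest even number not exceeding
        \<open>x\<close>, positive since \<open>x\<close> is at least 2. Rounding loses at most 2,
        hence the \<open>exp (x - 2)\<close>; smaller \<open>x\<close> are covered by the summand
        1.\<close>
      define m where "m = nat \<lfloor>x / 2\<rfloor> - 1"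
      have "real (Suc m) = of_int \<lfloor>x / 2\<rfloor>" using False by (simp add: m_def)
      then have m: "real (N m) \<le> x" "x \<le> real (N m) + 2"
        unfolding N_def by (simp_all del: of_nat_Suc) linarith+
      have "real (N m) powr q \<le> x powr q" using m q by (intro powr_mono2) auto
      also have "\<dots> = y / L" using y L q by (simp add: x_def powr_powr)
      finally have "exp 1 \<le> y / (D * real (N m) powr q)"
        using L D N[of m] by (simp add: L_def field_simps)
      then have "exp 1 ^ N m \<le> T m y" unfolding T_def by (intro power_mono) auto
      moreover have "exp (x - 2) \<le> exp 1 ^ N m"
        using m by (simp add: exp_of_nat_mult[symmetric])
      ultimately have "ennreal (exp (x - 2)) \<le> ennreal (T m y)" by (intro ennreal_leI) simp
      also have "\<dots> \<le> (\<Sum>m. ennreal (T m y))"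
        using sum_le_suminf[of "\<lambda>m. ennreal (T m y)" "{m}"] by simp
      finally show ?thesis by (simp add: add_increasing)
    qed
    have "ennreal (exp (c * y powr \<beta>)) \<le> ennreal (exp (c + 2)) * ennreal (exp (x - 2))"
      using ennreal_leI[OF 1] by (simp add: ennreal_mult')
    also have "\<dots> \<le> ennreal (exp (c + 2)) * (1 + (\<Sum>m. ennreal (T m y)))"
      by (rule mult_left_mono[OF 2]) simp
    finally show ?thesis .
  qed
  have T_int: "(\<integral>\<^sup>+ \<omega>. ennreal (T m (Y \<omega>)) \<partial>M) \<le> ennreal ((1 / 2) ^ Suc m)" for m
  proof -
    let ?d = "(D * real (N m) powr q) ^ N m"
    have d: "0 < ?d" using D N[of m] by simp
    have "(\<integral>\<^sup>+ \<omega>. ennreal (T m (Y \<omega>)) \<partial>M) = (\<integral>\<^sup>+ \<omega>. ennreal (1 / ?d) * ennreal (Y \<omega> ^ N m) \<partial>M)"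
      using d Y by (simp add: T_def power_divide ennreal_mult'[symmetric])
    also have "\<dots> = ennreal (1 / ?d) * (\<integral>\<^sup>+ \<omega>. ennreal (Y \<omega> ^ N m) \<partial>M)"
      by (rule nn_integral_cmult) measurable
    also have "\<dots> \<le> ennreal (1 / ?d) * ennreal ((C * real (N m) powr q) ^ N m)"
      by (intro mult_left_mono moments N) simp
    also have "\<dots> = ennreal ((C * real (N m) powr q) ^ N m / ?d)"
      using d by (simp add: ennreal_mult'[symmetric])
    also have "(C * real (N m) powr q) ^ N m / ?d = (1 / 2) ^ N m"
      unfolding power_divide[symmetric] using C N[of m] by (simp add: D_def)
    also have "ennreal ((1 / 2) ^ N m) \<le> ennreal ((1 / 2) ^ Suc m)"
      by (intro ennreal_leI power_decreasing) (simp_all add: N_def)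
    finally show ?thesis .
  qed
  have "(\<integral>\<^sup>+ \<omega>. ennreal (exp (c * Y \<omega> powr \<beta>)) \<partial>M)
      \<le> (\<integral>\<^sup>+ \<omega>. ennreal (exp (c + 2)) * (1 + (\<Sum>m. ennreal (T m (Y \<omega>)))) \<partial>M)"
    by (intro nn_integral_mono pt Y)
  also have "\<dots> = ennreal (exp (c + 2)) * (1 + (\<Sum>m. \<integral>\<^sup>+ \<omega>. ennreal (T m (Y \<omega>)) \<partial>M))"
    unfolding T_def
    by (subst nn_integral_cmult, measurable, subst nn_integral_add, measurable, subst nn_integral_suminf, measurable)
       (simp add: emeasure_space_1)
  also have "\<dots> \<le> ennreal (exp (c + 2)) * (1 + (\<Sum>m. ennreal ((1 / 2) ^ Suc m)))"
    by (intro mult_left_mono add_left_mono suminf_le T_int) auto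
  also have "(\<Sum>m. ennreal ((1 / 2) ^ Suc m)) = ennreal 1"
    by (rule suminf_ennreal_eq[OF _ power_half_series]) simp
  finally have "(\<integral>\<^sup>+ \<omega>. ennreal (exp (c * Y \<omega> powr \<beta>)) \<partial>M) \<le> ennreal (exp (c + 2)) * (1 + ennreal 1)" .
  also have "\<dots> < \<infinity>" by (simp add: ennreal_mult_less_top)
  finally show ?thesis using c by blast
qed

theorem theorem2p1:
  fixes M :: "'a measure" and X1 X2 :: "real \<Rightarrow> 'a \<Rightarrow> real"
    and \<alpha> \<sigma>1 \<sigma>2 \<beta> :: real and \<theta> :: "'a \<Rightarrow> complex"
  assumes "3/2 < \<alpha>" and "\<alpha> \<le> 2"
    and "sym_stable_process M \<alpha> \<sigma>1 X1"
    and "sym_stable_process M \<alpha> \<sigma>2 X2"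
    and "indep_processes M X1 X2"
    and "\<theta> \<in> borel_measurable M"
    and "conv_in_prob_at0 M (theta_eps X1 X2) \<theta>"
    and "0 \<le> \<beta>" and "\<beta> < \<alpha> / 3"
  shows "\<exists>C>0. (\<integral>\<^sup>+ \<omega>. ennreal (exp (C * cmod (\<theta> \<omega>) powr \<beta>)) \<partial>M) < \<infinity>"
proof -
  interpret prob_space M using assms(3) by (simp add: sym_stable_process_def)
  obtain C0 where C0: "0 < C0" and C0_bound: "\<And>n \<epsilon>. \<lbrakk>even n; 0 < n; 0 < \<epsilon>\<rbrakk> \<Longrightarrow>
      (\<integral>\<^sup>+ \<omega>. ennreal (cmod (theta_eps X1 X2 \<epsilon> \<omega>) ^ n) \<partial>M) \<le> ennreal ((C0 * real n powr (2 / \<alpha>)) ^ n)"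
    using theta_eps_moment_bound[OF assms(1,3,4,5)] by blast
  \<comment> \<open>The added 1 gives \<open>1 \<le> C\<close>, so \<open>(C * ?r) ^ n\<close>
    absorbs the additive 1 produced by the passage to the limit. Of the factor 4 below, one 2 comes
    from that passage and one from this absorption.\<close>
  define C where "C = C0 + 1"
  have moments: "(\<integral>\<^sup>+ \<omega>. ennreal (cmod (\<theta> \<omega>) ^ n) \<partial>M) \<le> ennreal (((4 * C) * real n powr (2 / \<alpha>)) ^ n)"
    if n: "even n" "0 < n" for n
  proof -
    let ?r = "real n powr (2 / \<alpha>)"
    have r: "1 \<le> ?r" using n assms(1) by (intro ge_one_powr_ge_zero) auto
    have "(\<integral>\<^sup>+ \<omega>. ennreal (cmod (\<theta> \<omega>) ^ n) \<partial>M) \<le> ennreal (2 ^ n * ((C0 * ?r) ^ n + 1))"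
      by (rule moment_le_of_conv_in_prob[OF assms(7,6) borel_measurable_theta_eps[OF assms(3,4)] C0_bound[OF n]])
         (use C0 in auto)
    also have "\<dots> \<le> ennreal ((4 * C * ?r) ^ n)"
    proof (rule ennreal_leI)
      have "(C0 * ?r) ^ n \<le> (C * ?r) ^ n" using C0 by (intro power_mono mult_right_mono) (auto simp: C_def)
      moreover have "1 \<le> (C * ?r) ^ n"
        using C0 r mult_mono[of 1 C 1 ?r] by (intro one_le_power) (auto simp: C_def)
      ultimately have "2 ^ n * ((C0 * ?r) ^ n + 1) \<le> 2 ^ n * (2 * (C * ?r) ^ n)"
        by (intro mult_left_mono) auto
      also have "\<dots> \<le> 2 ^ n * (2 ^ n * (C * ?r) ^ n)"
        using n C0 r self_le_power[of "2::real" n] by (intro mult_left_mono mult_right_mono) (auto simp: C_def)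
      also have "\<dots> = (2 * (2 * (C * ?r))) ^ n"
        by (simp only: power_mult_distrib)
      also have "2 * (2 * (C * ?r)) = 4 * C * ?r"
        by simp
      finally show "2 ^ n * ((C0 * ?r) ^ n + 1) \<le> (4 * C * ?r) ^ n" .
    qed
    finally show ?thesis .
  qed
  show ?thesis
    \<comment> \<open>With \<open>q = 2 / \<alpha>\<close> the admissible orders reach
      \<open>1 / q = \<alpha> / 2\<close>, and \<open>\<beta>\<close> lies below
      \<open>\<alpha> / 3\<close>.\<close>
    by (rule exp_integrable_of_moments[where q="2 / \<alpha>" and C="4 * C", OF _ _ _ _ assms(8) _ moments])
       (use assms C0 in \<open>auto simp: C_def\<close>)
qed

end
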